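(* Let $(\Omega,\mathcal{F},\mathbb{P})$ be a probability space, let $\mathcal{C}\subseteq \mathbb{L}^0_+$ be convex, and let $g\in\mathcal{C}$ be strictly positive on $\mathcal{C}$. Let $\mathsf{cs}_g(\mathcal{C})$ be the intersection of all sets $\mathcal{K}\subseteq\mathbb{L}^0_+$ such that (CS1) $\mathcal{C}\subseteq\mathcal{K}$; (CS2) $\mathcal{K}$ is convex and closed; (CS3) if $f\in\mathcal{K}$ and $\delta\in\mathbb{R}_+$ are such that $(1+\delta)f-\delta g\in\mathbb{L}^0_+$, then $(1+\delta)f-\delta g\in\mathcal{K}$. Then $g$ is a numéraire of $\mathcal{C}$ if and only if $\mathsf{cs}_g(\mathcal{C})$ is bounded.
   Context: $(\Omega,\mathcal{F},\mathbb{P})$ is a probability space and $\Pi$ is the collection of all probabilities on $(\Omega,\mathcal{F})$ that are equivalent to $\mathbb{P}$ (same null sets). $\mathbb{L}^0$ is the set of all equivalence classes (modulo $\mathbb{P}$-a.s. equality) of finite real-valued random variables on $(\Omega,\mathcal{F})$, and $\mathbb{L}^0_+$ is the set of $f\in\mathbb{L}^0$ with $\mathbb{P}[f<0]=0$. $\mathbb{R}_+=[0,\infty)$. For $\mathbb{Q}\in\Pi$, $\mathbb{E}_{\mathbb{Q}}$ denotes expectation under $\mathbb{Q}$ (of elements of $\mathbb{L}^0_+$, with values in $[0,\infty]$). The topology on $\mathbb{L}^0$ is that of convergence in probability, induced by the metric $d_{\mathbb{Q}}(f,g)=\mathbb{E}_{\mathbb{Q}}[\min\{|f-g|,1\}]$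 for any $\mathbb{Q}\in\Pi$ (the topology does not depend on $\mathbb{Q}\in\Pi$). "Closed" refers to this topology. A set $\mathcal{K}\subseteq\mathbb{L}^0_+$ is called bounded if $\lim_{\ell\to\infty}\sup_{f\in\mathcal{K}}\mathbb{Q}[f>\ell]=0$ for some (equivalently, all) $\mathbb{Q}\in\Pi$. For a convex set $\mathcal{C}\subseteq\mathbb{L}^0_+$ and $g\in\mathcal{C}$: $g$ is strictly positive on $\mathcal{C}$ if $\mathbb{P}[f>0,\,g=0]=0$ for all $f\in\mathcal{C}$. $g$ is a numéraire of $\mathcal{C}$ if it is strictly positive on $\mathcal{C}$ and there exists $\mathbb{Q}\in\Pi$ such that $\mathbb{E}_{\mathbb{Q}}[f/g\mid g>0]\le 1$ for all $f\in\mathcal{C}$. Here the conditional expectation is given the event $\{g>0\}$, so the condition means $\mathbb{E}_{\mathbb{Q}}[(f/g)\mathbb{I}_{\{g>0\}}]\le\mathbb{Q}[g>0]$ (with $(f/g)\mathbb{I}_{\{g>0\}}=0$ on $\{g=0\}$); in the trivial case $\mathbb{P}[g>0]=0$ (i.e. $\mathcal{C}=\{0\}$) the condition is understood in this latter form. *)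

theory Defs
  imports "HOL-Probability.Probability"
begin

text \<open>An element of \<open>L0 M\<close> is literally an equivalence class, i.e. a set of measurable functions.
  All notions on classes below are evaluated at a representative chosen by \<open>rep\<close>; by
  \<open>AE_rep_L0_class\<close> the choice is immaterial up to null sets.\<close>

definition ae_eq :: "'a measure \<Rightarrow> (('a \<Rightarrow> real) \<times> ('a \<Rightarrow> real)) set" where
  "ae_eq M = {(f, h). f \<in> borel_measurable M \<and> h \<in> borel_measurable M \<and> (AE x in M. f x = h x)}"

definition L0 :: "'a measure \<Rightarrow> ('a \<Rightarrow> real) set set" where
  "L0 M = borel_measurable M // ae_eq M"

definition L0_class :: "'a measure \<Rightarrow> ('a \<Rightarrow> real) \<Rightarrow> ('a \<Rightarrow> real) set" where
  "L0_class M f = ae_eq M `` {f}"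

definition rep :: "('a \<Rightarrow> real) set \<Rightarrow> 'a \<Rightarrow> real" where
  "rep F = (SOME f. f \<in> F)"

definition L0_plus :: "'a measure \<Rightarrow> ('a \<Rightarrow> real) set set" where
  "L0_plus M = {F \<in> L0 M. measure M {x \<in> space M. rep F x < 0} = 0}"

definition lincomb ::
  "'a measure \<Rightarrow> real \<Rightarrow> ('a \<Rightarrow> real) set \<Rightarrow> real \<Rightarrow> ('a \<Rightarrow> real) set \<Rightarrow> ('a \<Rightarrow> real) set" where
  "lincomb M a F b H = L0_class M (\<lambda>x. a * rep F x + b * rep H x)"

definition L0_convex :: "'a measure \<Rightarrow> ('a \<Rightarrow> real) set set \<Rightarrow> bool" where
  "L0_convex M K \<longleftrightarrow> (\<forall>F\<in>K. \<forall>H\<in>K. \<forall>t\<in>{0..1}. lincomb M (1 - t) F t H \<in> K)"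

definition equiv_probs :: "'a measure \<Rightarrow> 'a measure set" where
  "equiv_probs M = {Q. prob_space Q \<and> sets Q = sets M \<and> null_sets Q = null_sets M}"

definition L0_dist :: "'a measure \<Rightarrow> ('a \<Rightarrow> real) set \<Rightarrow> ('a \<Rightarrow> real) set \<Rightarrow> real" where
  "L0_dist Q F H = integral\<^sup>L Q (\<lambda>x. min \<bar>rep F x - rep H x\<bar> 1)"

text \<open>The topology of convergence in probability; every \<open>L0_dist Q\<close> with \<open>Q \<in> equiv_probs M\<close>
  induces the same one, and \<open>M\<close> itself is used here.\<close>

definition L0_topology :: "'a measure \<Rightarrow> ('a \<Rightarrow> real) set topology" where
  "L0_topology M = Metric_space.mtopology (L0 M) (L0_dist M)"

text \<open>The supremum is taken in \<open>ennreal\<close>, so that it is meaningful for every \<open>K\<close>.\<close>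

definition L0_bounded :: "'a measure \<Rightarrow> ('a \<Rightarrow> real) set set \<Rightarrow> bool" where
  "L0_bounded M K \<longleftrightarrow> (\<exists>Q\<in>equiv_probs M.
     ((\<lambda>l::real. SUP F\<in>K. emeasure Q {x \<in> space Q. rep F x > l}) \<longlongrightarrow> 0) at_top)"

definition strictly_positive_on ::
  "'a measure \<Rightarrow> ('a \<Rightarrow> real) set set \<Rightarrow> ('a \<Rightarrow> real) set \<Rightarrow> bool" where
  "strictly_positive_on M C G \<longleftrightarrow>
     (\<forall>F\<in>C. measure M {x \<in> space M. rep F x > 0 \<and> rep G x = 0} = 0)"

text \<open>The condition \<open>E\<^sub>Q[F/G | G > 0] \<le> 1\<close> is stated multiplied by \<open>Q[G > 0]\<close>, which also gives it
  a meaning when \<open>G = 0\<close> almost surely.\<close>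

definition numeraire ::
  "'a measure \<Rightarrow> ('a \<Rightarrow> real) set set \<Rightarrow> ('a \<Rightarrow> real) set \<Rightarrow> bool" where
  "numeraire M C G \<longleftrightarrow> G \<in> C \<and> strictly_positive_on M C G \<and>
     (\<exists>Q\<in>equiv_probs M. \<forall>F\<in>C.
        (\<integral>\<^sup>+x. ennreal (rep F x / rep G x) * indicator {x \<in> space Q. rep G x > 0} x \<partial>Q)
          \<le> emeasure Q {x \<in> space Q. rep G x > 0})"

definition cs :: "'a measure \<Rightarrow> ('a \<Rightarrow> real) set \<Rightarrow> ('a \<Rightarrow> real) set set \<Rightarrow> ('a \<Rightarrow> real) set set" where
  "cs M G C = \<Inter>{K. K \<subseteq> L0_plus M \<and> C \<subseteq> K \<and>
     L0_convex M K \<and> closedin (L0_topology M) K \<and>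
     (\<forall>F\<in>K. \<forall>\<delta>\<ge>0. lincomb M (1 + \<delta>) F (- \<delta>) G \<in> L0_plus M \<longrightarrow>
        lincomb M (1 + \<delta>) F (- \<delta>) G \<in> K)}"

lemma equiv_ae_eq: "equiv (borel_measurable M) (ae_eq M)"
proof (rule equivI)
  show "trans (ae_eq M)"
  proof (rule transI)
    fix f g h assume *: "(f, g) \<in> ae_eq M" "(g, h) \<in> ae_eq M"
    then have "AE x in M. f x = g x" "AE x in M. g x = h x" by (auto simp: ae_eq_def)
    then have "AE x in M. f x = h x" by eventually_elim simp
    with * show "(f, h) \<in> ae_eq M" by (auto simp: ae_eq_def)
  qed
qed (auto simp: ae_eq_def refl_on_def sym_def eq_commute)

lemma L0_class_in_L0: "f \<in> borel_measurable M \<Longrightarrow> L0_class M f \<in> L0 M"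
  unfolding L0_def L0_class_def by (rule quotientI)

lemma rep_in: assumes "F \<in> L0 M" shows "rep F \<in> F"
proof -
  have "F \<noteq> {}" using assms in_quotient_imp_non_empty[OF equiv_ae_eq] by (auto simp: L0_def)
  then show ?thesis unfolding rep_def by (simp add: some_in_eq)
qed

lemma rep_measurable [measurable]: assumes "F \<in> L0 M" shows "rep F \<in> borel_measurable M"
  using rep_in[OF assms] in_quotient_imp_subset[OF equiv_ae_eq] assms by (auto simp: L0_def)

lemma AE_rep_L0_class: assumes "f \<in> borel_measurable M" shows "AE x in M. rep (L0_class M f) x = f x"
proof -
  have "rep (L0_class M f) \<in> L0_class M f" by (rule rep_in[OF L0_class_in_L0[OF assms]])
  then show ?thesis by (auto simp: L0_class_def ae_eq_def eq_commute)
qed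

lemma L0_eq_iff:
  assumes "F \<in> L0 M" "H \<in> L0 M"
  shows "F = H \<longleftrightarrow> (AE x in M. rep F x = rep H x)"
proof
  assume "AE x in M. rep F x = rep H x"
  then have "(rep F, rep H) \<in> ae_eq M" using assms by (auto simp: ae_eq_def rep_measurable)
  then show "F = H"
    using quotient_eqI[OF equiv_ae_eq] assms rep_in[OF assms(1)] rep_in[OF assms(2)]
    unfolding L0_def by blast
qed simp

lemma Metric_space_L0:
  assumes "prob_space M"
  shows "Metric_space (L0 M) (L0_dist M)"
proof -
  interpret prob_space M by fact
  have int: "integrable M (\<lambda>x. min \<bar>rep F x - rep H x\<bar> 1)" if "F \<in> L0 M" "H \<in> L0 M" for F H
    using that by (intro integrable_const_bound[where B=1]) auto
  show ?thesis
  proof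
    show "0 \<le> L0_dist M F H" for F H unfolding L0_dist_def by (intro integral_nonneg_AE) auto
    show "L0_dist M F H = L0_dist M H F" for F H
      unfolding L0_dist_def by (simp add: abs_minus_commute)
    fix F H assume FH: "F \<in> L0 M" "H \<in> L0 M"
    show "L0_dist M F H = 0 \<longleftrightarrow> F = H"
    proof -
      have "L0_dist M F H = 0 \<longleftrightarrow> (AE x in M. min \<bar>rep F x - rep H x\<bar> 1 = 0)"
        unfolding L0_dist_def by (intro integral_nonneg_eq_0_iff_AE int FH) auto
      also have "\<dots> \<longleftrightarrow> (AE x in M. rep F x = rep H x)"
        by (intro AE_cong) (auto simp: min_def)
      finally show ?thesis using L0_eq_iff[OF FH] by simp
    qed
    fix K assume K: "K \<in> L0 M"
    have "L0_dist M F K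
        \<le> integral\<^sup>L M (\<lambda>x. min \<bar>rep F x - rep H x\<bar> 1 + min \<bar>rep H x - rep K x\<bar> 1)"
      unfolding L0_dist_def
      by (intro integral_mono int Bochner_Integration.integrable_add FH K) auto
    also have "\<dots> = L0_dist M F H + L0_dist M H K"
      unfolding L0_dist_def by (intro Bochner_Integration.integral_add int FH K)
    finally show "L0_dist M F K \<le> L0_dist M F H + L0_dist M H K" .
  qed
qed

end

theory Submission
  imports Defs
begin

text \<open>
If \<open>g\<close> is a numeraire, witnessed by \<open>Q\<close>, then the inequality \<open>E\<^sub>Q[f / g; g > 0] \<le> Q[g > 0]\<close> survives
all the operations that generate \<open>cs M g C\<close>, and Markov's inequality bounds its solutions in
probability (\<open>numeraire_imp_cs_bounded\<close>).

Conversely, divide by \<open>g\<close>, so that the candidate numeraire becomes \<open>1\<close>.  This yields a convex set \<open>D\<close>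
of nonnegative functions, closed and bounded in probability, that contains \<open>1\<close> and is stable under
extrapolation away from \<open>1\<close> as long as the result stays nonnegative.  What is needed is an integrable
density \<open>y > 0\<close> with \<open>E[y * f] \<le> E[y]\<close> for all \<open>f \<in> D\<close>: a separating density for the cone
generated by \<open>D - 1\<close>.  It is obtained from utility maximisation.

Think of \<open>J n = {n * (f - 1) | f \<in> D}\<close> as the positions with losses at most \<open>n\<close>.  For a concave
utility that is bounded above, let \<open>h\<close> be a maximiser of expected utility over \<open>J n\<close> and \<open>y\<close> the
marginal utility at \<open>h\<close>.  The first-order condition says \<open>E[y * (z - h)] \<le> 0\<close> for \<open>z \<in> J n\<close>.  With
\<open>z = n * (f - 1)\<close> this is \<open>E[y * (f - 1)] \<le> E[y * h] / n\<close>, an error that tends to \<open>0\<close>.  With \<open>z = 0\<close> it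
is \<open>E[y * h] \<ge> 0\<close>; as marginal utility is large only where the loss is large, this makes the
densities \<open>y\<close> uniformly integrable in \<open>n\<close> (\<open>approximate_density\<close>).

The limit could still be zero, namely if utilities arbitrarily close to the upper bound were reached. This is
where boundedness in probability enters. Over \<open>J 1\<close> the supremum of the utility \<open>1 - exp (-
x)\<close>, earned on an event \<open>A\<close> only, is less than the probability of \<open>A\<close>. By
compactness of \<open>D\<close> and extrapolation, heavy enough penalties on losses beyond \<open>1, 2, 3,
\<dots>\<close> keep it bounded away from that value over all the \<open>J n\<close>
(\<open>penalty_weight_exists\<close>, \<open>bounded_utility_family\<close>). The weights of the penalties
have to depend on \<open>D\<close>: a fixed utility, such as the exponential one, would only produce densities
with additional integrability (finite entropy), and these need not exist. The limit density then charges
\<open>A\<close> (\<open>separating_density_charging\<close>), and an exhaustion argument over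
\<open>A\<close> makes it positive almost everywhere (\<open>separating_density\<close>).

All limits come from \<open>convergent_selection\<close>: a decreasing sequence of nonempty convex sets of
nonnegative functions, bounded in probability, admits an almost surely convergent selection.
\<close>

section \<open>Limits and bounds for integrals\<close>

lemma Fatou_integral_le:
  fixes v :: "nat \<Rightarrow> 'a \<Rightarrow> real"
  assumes int: "\<And>i. integrable M (v i)" and nonneg: "\<And>i. AE x in M. 0 \<le> v i x"
    and le: "\<And>i. (\<integral>x. v i x \<partial>M) \<le> c"
    and [measurable]: "w \<in> borel_measurable M" and lim: "AE x in M. (\<lambda>i. v i x) \<longlonglongrightarrow> w x"
  shows "integrable M w" "(\<integral>x. w x \<partial>M) \<le> c"
proof -
  have [measurable]: "v i \<in> borel_measurable M" for i using int by auto
  have w_nonneg: "AE x in M. 0 \<le> w x"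
  proof -
    have "AE x in M. \<forall>i. 0 \<le> v i x" using nonneg by (simp add: AE_all_countable)
    then show ?thesis using lim by eventually_elim (rule LIMSEQ_le_const, auto)
  qed
  have "(\<integral>\<^sup>+x. ennreal (w x) \<partial>M) = (\<integral>\<^sup>+x. liminf (\<lambda>i. ennreal (v i x)) \<partial>M)"
    using lim
    by (intro nn_integral_cong_AE, eventually_elim) (auto intro!: lim_imp_Liminf[symmetric] tendsto_ennrealI)
  also have "\<dots> \<le> liminf (\<lambda>i. \<integral>\<^sup>+x. ennreal (v i x) \<partial>M)" by (rule nn_integral_liminf) measurable
  also have "\<dots> \<le> ennreal c"
  proof (rule Liminf_le)
    show "\<forall>\<^sub>F i in sequentially. (\<integral>\<^sup>+x. ennreal (v i x) \<partial>M) \<le> ennreal c"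
      using le by (intro always_eventually allI) (simp add: nn_integral_eq_integral int nonneg ennreal_leI)
  qed simp
  finally have *: "(\<integral>\<^sup>+x. ennreal (w x) \<partial>M) \<le> ennreal c" .
  then show "integrable M w" using w_nonneg
    by (intro integrableI_nonneg) (auto simp: less_top[symmetric] top_unique)
  then have "ennreal (\<integral>x. w x \<partial>M) \<le> ennreal c" using * w_nonneg by (simp add: nn_integral_eq_integral)
  moreover have "0 \<le> c"
    using integral_nonneg_AE[OF nonneg, of 0] le[of 0] by linarith
  ultimately show "(\<integral>x. w x \<partial>M) \<le> c" by simp
qed

lemma nn_integral_midpoint:
  assumes [measurable]: "f \<in> borel_measurable M" "h \<in> borel_measurable M" "w \<in> borel_measurable M"
    and "\<And>x. 0 \<le> f x" "\<And>x. 0 \<le> h x"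
  shows "(\<integral>\<^sup>+x. ennreal ((f x + h x) / 2) * w x \<partial>M)
    = ennreal (1/2) * ((\<integral>\<^sup>+x. ennreal (f x) * w x \<partial>M) + (\<integral>\<^sup>+x. ennreal (h x) * w x \<partial>M))"
proof -
  have "ennreal ((f x + h x) / 2) = ennreal (1/2) * (ennreal (f x) + ennreal (h x))" for x
  proof -
    have "ennreal ((f x + h x) / 2) = ennreal (1/2 * (f x + h x))" by simp
    also have "\<dots> = ennreal (1/2) * ennreal (f x + h x)" by (rule ennreal_mult) (use assms(4,5) in auto)
    also have "ennreal (f x + h x) = ennreal (f x) + ennreal (h x)" by (rule ennreal_plus[OF assms(4,5)])
    finally show ?thesis .
  qed
  then have "(\<integral>\<^sup>+x. ennreal ((f x + h x) / 2) * w x \<partial>M)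
    = (\<integral>\<^sup>+x. ennreal (1/2) * (ennreal (f x) * w x + ennreal (h x) * w x) \<partial>M)"
    by (simp add: algebra_simps)
  then show ?thesis by (simp add: nn_integral_cmult nn_integral_add)
qed

lemma ennreal_half_add_self: "ennreal (1/2) * (ennreal e + ennreal e) = ennreal e"
proof (cases "0 \<le> e")
  case True
  then have "ennreal e + ennreal e = ennreal (2 * e)" by (simp flip: ennreal_plus)
  moreover have "ennreal (1/2) * ennreal (2 * e) = ennreal (1/2 * (2 * e))"
    using True by (intro ennreal_mult[symmetric]) auto
  ultimately show ?thesis by simp
qed (simp add: ennreal_neg)

lemma nn_integral_le_cap_plus_excess:
  assumes [measurable]: "u \<in> borel_measurable M" "B \<in> sets M" and "0 \<le> c"
  shows "(\<integral>\<^sup>+x. ennreal (u x) * indicator B x \<partial>M)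
    \<le> (\<integral>\<^sup>+x. ennreal (min (u x) c) * indicator B x \<partial>M) + (\<integral>\<^sup>+x. ennreal (u x - c) \<partial>M)"
proof -
  have "ennreal (u x) * indicator B x \<le> ennreal (min (u x) c) * indicator B x + ennreal (u x - c)" for x
    using assms(3) by (auto simp: indicator_def min_def simp flip: ennreal_plus)
  then have "(\<integral>\<^sup>+x. ennreal (u x) * indicator B x \<partial>M)
    \<le> (\<integral>\<^sup>+x. ennreal (min (u x) c) * indicator B x + ennreal (u x - c) \<partial>M)"
    by (intro nn_integral_mono)
  also have "\<dots> = (\<integral>\<^sup>+x. ennreal (min (u x) c) * indicator B x \<partial>M) + (\<integral>\<^sup>+x. ennreal (u x - c) \<partial>M)"
    by (rule nn_integral_add) measurable
  finally show ?thesis .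
qed

text \<open>The excess bound is a form of uniform integrability that, unlike the usual one, is visibly preserved
by convex combinations of nonnegative functions.\<close>

lemma (in prob_space) nn_integral_tendsto_of_excess_bound:
  assumes [measurable]: "\<And>i. u i \<in> borel_measurable M" "y \<in> borel_measurable M" "B \<in> sets M"
    and G: "\<And>m. 0 \<le> G m"
    and excess: "\<And>i m. (\<integral>\<^sup>+x. ennreal (u i x - G m) \<partial>M) \<le> ennreal (1 / real (Suc m))"
    and lim: "AE x in M. (\<lambda>i. u i x) \<longlonglongrightarrow> y x"
  shows "(\<lambda>i. \<integral>\<^sup>+x. ennreal (u i x) * indicator B x \<partial>M) \<longlonglongrightarrow> (\<integral>\<^sup>+x. ennreal (y x) * indicator B x \<partial>M)"
    (is "?I \<longlonglongrightarrow> ?L")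
proof -
  have "limsup ?I \<le> ?L + ennreal (1 / real (Suc m))" for m
  proof -
    let ?J = "\<lambda>i. \<integral>\<^sup>+x. ennreal (min (u i x) (G m)) * indicator B x \<partial>M"
    have "?J \<longlonglongrightarrow> (\<integral>\<^sup>+x. ennreal (min (y x) (G m)) * indicator B x \<partial>M)"
    proof (rule nn_integral_dominated_convergence[where w="\<lambda>_. ennreal (G m)"])
      show "AE x in M. ennreal (min (u i x) (G m)) * indicator B x \<le> ennreal (G m)" for i
        by (auto simp: indicator_def intro!: ennreal_leI)
      show "AE x in M. (\<lambda>i. ennreal (min (u i x) (G m)) * indicator B x)
          \<longlonglongrightarrow> ennreal (min (y x) (G m)) * indicator B x"
        using lim by eventually_elim
          (auto simp: indicator_def intro!: tendsto_ennrealI tendsto_min)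
      show "(\<integral>\<^sup>+x. ennreal (G m) \<partial>M) < \<infinity>" by (simp add: emeasure_space_1)
    qed measurable
    then have "(\<lambda>i. ?J i + ennreal (1 / real (Suc m)))
        \<longlonglongrightarrow> (\<integral>\<^sup>+x. ennreal (min (y x) (G m)) * indicator B x \<partial>M) + ennreal (1 / real (Suc m))"
      by (intro tendsto_add tendsto_const)
    then have "limsup (\<lambda>i. ?J i + ennreal (1 / real (Suc m)))
        = (\<integral>\<^sup>+x. ennreal (min (y x) (G m)) * indicator B x \<partial>M) + ennreal (1 / real (Suc m))"
      by (intro lim_imp_Limsup) auto
    moreover have "limsup ?I \<le> limsup (\<lambda>i. ?J i + ennreal (1 / real (Suc m)))"
    proof (intro Limsup_mono always_eventually allI)
      fix i
      have "?I i \<le> ?J i + (\<integral>\<^sup>+x. ennreal (u i x - G m) \<partial>M)"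
        by (rule nn_integral_le_cap_plus_excess[OF _ _ G]) auto
      also have "\<dots> \<le> ?J i + ennreal (1 / real (Suc m))" by (intro add_left_mono excess)
      finally show "?I i \<le> ?J i + ennreal (1 / real (Suc m))" .
    qed
    ultimately have "limsup ?I
        \<le> (\<integral>\<^sup>+x. ennreal (min (y x) (G m)) * indicator B x \<partial>M) + ennreal (1 / real (Suc m))" by simp
    also have "\<dots> \<le> ?L + ennreal (1 / real (Suc m))"
      by (intro add_right_mono nn_integral_mono mult_right_mono ennreal_leI) auto
    finally show ?thesis .
  qed
  moreover have "(\<lambda>m. ?L + ennreal (1 / real (Suc m))) \<longlonglongrightarrow> ?L + ennreal 0"
    by (intro tendsto_add tendsto_const tendsto_ennrealI LIMSEQ_Suc lim_1_over_n)
  ultimately have "limsup ?I \<le> ?L" by (intro LIMSEQ_le_const[where X="\<lambda>m. ?L + ennreal (1 / real (Suc m))"]) auto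
  moreover have "?L \<le> liminf ?I"
  proof -
    have "?L = (\<integral>\<^sup>+x. liminf (\<lambda>i. ennreal (u i x) * indicator B x) \<partial>M)"
      using lim by (intro nn_integral_cong_AE, eventually_elim)
        (auto simp: indicator_def Liminf_const intro!: lim_imp_Liminf[symmetric] tendsto_ennrealI)
    also have "\<dots> \<le> liminf ?I" by (rule nn_integral_liminf) measurable
    finally show ?thesis .
  qed
  ultimately show ?thesis
    using Liminf_le_Limsup[of sequentially ?I] by (intro Liminf_eq_Limsup) auto
qed

lemma (in prob_space) tail_le:
  assumes [measurable]: "f \<in> borel_measurable M" and "0 < \<epsilon>"
  shows "\<exists>n::nat. prob {x \<in> space M. real n < f x} \<le> \<epsilon>"
proof -
  define T where "T n = {x \<in> space M. real n < f x}" for n :: nat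
  have "(\<lambda>n. prob (T n)) \<longlonglongrightarrow> prob (\<Inter>n. T n)"
    by (rule finite_Lim_measure_decseq) (auto simp: T_def decseq_def)
  moreover have "(\<Inter>n. T n) = {}"
  proof -
    have "x \<notin> (\<Inter>n. T n)" for x
    proof -
      obtain n where "f x \<le> real n" using real_arch_simple by blast
      then have "x \<notin> T n" by (simp add: T_def)
      then show ?thesis by blast
    qed
    then show ?thesis by blast
  qed
  ultimately have "(\<lambda>n. prob (T n)) \<longlonglongrightarrow> 0" by simp
  then have "eventually (\<lambda>n. prob (T n) < \<epsilon>) sequentially" using assms(2) by (rule order_tendstoD(2))
  then show ?thesis unfolding T_def by (auto simp: eventually_sequentially intro: less_imp_le)
qed

section \<open>Convergent selections from convex sets\<close>

text \<open>Nearly minimising the strictly convex functional \<open>f \<mapsto> E[exp (- f)]\<close> over each of the sets pins the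
minimisers down: the midpoint defect of \<open>exp (- x)\<close> is the square
\<open>(exp (- a / 2) - exp (- b / 2))\<^sup>2\<close>, so approximate minimisers make \<open>exp (- u n / 2)\<close> a Cauchy
sequence in mean square.  This takes the place of extracting convergent sequences of forward convex
combinations.\<close>

lemma (in prob_space) exponential_Cauchy_selection:
  fixes A :: "nat \<Rightarrow> ('a \<Rightarrow> real) set"
  assumes dec: "\<And>n. A (Suc n) \<subseteq> A n"
    and ne: "\<And>n. A n \<noteq> {}"
    and meas: "\<And>n f. f \<in> A n \<Longrightarrow> f \<in> borel_measurable M"
    and nonneg: "\<And>n f x. f \<in> A n \<Longrightarrow> 0 \<le> f x"
    and mid: "\<And>n f h. f \<in> A n \<Longrightarrow> h \<in> A n \<Longrightarrow> (\<lambda>x. (f x + h x) / 2) \<in> A n"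
  shows "\<exists>u. (\<forall>n. u n \<in> A n) \<and> (AE x in M. Cauchy (\<lambda>n. exp (- u n x / 2)))"
proof -
  define I where "I f = (\<integral>x. exp (- f x) \<partial>M)" for f :: "'a \<Rightarrow> real"
  have bounded_exp: "integrable M (\<lambda>x. exp (- f x))" if "f \<in> A n" for f n
    by (rule integrable_const_bound[where B=1]) (use meas[OF that] nonneg[OF that] in auto)
  have antiA: "A m \<subseteq> A n" if "n \<le> m" for n m
    using lift_Suc_antimono_le[of A, OF dec that] .
  define s where "s n = (INF f\<in>A n. I f)" for n
  have I_nonneg: "0 \<le> I f" for f unfolding I_def by (rule Bochner_Integration.integral_nonneg) simp
  have bdd: "bdd_below (I ` B)" for B using I_nonneg by (auto intro!: bdd_belowI[of _ 0])
  have I_le: "I f \<le> 1" if "f \<in> A n" for f n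
  proof -
    have "I f \<le> (\<integral>x. 1 \<partial>M)"
      unfolding I_def by (rule integral_mono[OF bounded_exp[OF that]]) (use nonneg[OF that] in auto)
    then show ?thesis by (simp add: prob_space)
  qed
  have s_le: "s n \<le> I f" if "f \<in> A n" for f n
    unfolding s_def by (rule cINF_lower[OF bdd that])
  have s_mono: "s n \<le> s m" if "n \<le> m" for n m
    unfolding s_def by (rule cINF_superset_mono[OF ne bdd antiA[OF that]]) simp
  have "s n \<le> 1" for n using ne[of n] s_le[of _ n] I_le[of _ n] by fastforce
  moreover have "incseq s" using s_mono by (auto simp: incseq_def)
  ultimately have "convergent s" by (intro Bseq_mono_convergent BseqI'[of _ 1])
      (use s_mono in \<open>auto simp: s_def intro!: abs_leI order_trans[OF _ cINF_greatest[OF ne I_nonneg]]\<close>)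
  then have s_Cauchy: "Cauchy s" by (rule convergent_Cauchy)
  have "\<exists>f. f \<in> A n \<and> I f < s n + 1 / real (Suc n)" for n
  proof -
    have "(INF f\<in>A n. I f) < s n + 1 / real (Suc n)" by (simp add: s_def)
    then show ?thesis using cINF_less_iff[OF ne bdd] by blast
  qed
  then obtain v where v: "\<And>n. v n \<in> A n" "\<And>n. I (v n) < s n + 1 / real (Suc n)" by metis
  define w where "w n x = exp (- v n x / 2)" for n x
  have [measurable]: "v n \<in> borel_measurable M" for n using meas v by blast
  have w01: "0 < w n x" "w n x \<le> 1" for n x using nonneg[OF v(1)] by (auto simp: w_def)
  have w_int: "integrable M (w n)" for n
    unfolding w_def by (rule integrable_const_bound[where B=1]) (use nonneg[OF v(1)] in auto)
  have sq_int: "integrable M (\<lambda>x. (w i x - w j x)\<^sup>2)" for i j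
  proof (rule integrable_const_bound[where B=1])
    have "\<bar>w i x - w j x\<bar> \<le> 1" for x using w01[of i x] w01[of j x] by linarith
    then show "AE x in M. norm ((w i x - w j x)\<^sup>2) \<le> 1"
      by (simp add: abs_square_le_1)
  qed (simp add: w_def)
  have sq: "(\<integral>x. (w i x - w j x)\<^sup>2 \<partial>M) \<le> s j - s i + 2 / real (Suc i)" if "i \<le> j" for i j
  proof -
    have vj: "v j \<in> A i" using v(1) antiA[OF that] by blast
    let ?m = "\<lambda>x. (v i x + v j x) / 2"
    have m: "?m \<in> A i" by (rule mid[OF v(1) vj])
    \<comment> \<open>midpoint defect of \<open>exp (- x)\<close>, an exact square\<close>
    have "(w i x - w j x)\<^sup>2 = exp (- v i x) + exp (- v j x) - 2 * exp (- ?m x)" for x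
      by (simp add: w_def power2_eq_square algebra_simps exp_add[symmetric] add_divide_distrib)
    then have "(\<integral>x. (w i x - w j x)\<^sup>2 \<partial>M) = I (v i) + I (v j) - 2 * I ?m"
      using bounded_exp[OF v(1)[of i]] bounded_exp[OF v(1)[of j]] bounded_exp[OF m]
      by (simp add: I_def)
    also have "\<dots> \<le> (s i + 1 / real (Suc i)) + (s j + 1 / real (Suc j)) - 2 * s i"
      using v(2)[of i] v(2)[of j] s_le[OF m] by linarith
    also have "\<dots> \<le> s j - s i + 2 / real (Suc i)"
      using frac_le[of 1 1 "real (Suc i)" "real (Suc j)"] that by simp
    finally show ?thesis .
  qed
  have "\<exists>N. \<forall>i\<ge>N. \<forall>j\<ge>N. (\<integral>x. norm (w i x - w j x) \<partial>M) < e" if "e > 0" for e :: real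
  proof -
    define \<eta> where "\<eta> = e / 4"
    have \<eta>: "\<eta> > 0" using that by (simp add: \<eta>_def)
    obtain N1 where N1: "\<And>i j. i \<ge> N1 \<Longrightarrow> j \<ge> N1 \<Longrightarrow> norm (s i - s j) < \<eta>\<^sup>2"
      using CauchyD[OF s_Cauchy, of "\<eta>\<^sup>2"] \<eta> by auto
    obtain N2 where N2: "1 / real (Suc N2) < \<eta>\<^sup>2"
      using nat_approx_posE[of "\<eta>\<^sup>2"] \<eta> by auto
    have *: "(\<integral>x. norm (w i x - w j x) \<partial>M) < e" if "max N1 N2 \<le> i" "i \<le> j" for i j
    proof -
      have "1 / real (Suc i) \<le> 1 / real (Suc N2)" using that by (simp add: frac_le)
      then have sq_le: "(\<integral>x. (w i x - w j x)\<^sup>2 \<partial>M) \<le> 3 * \<eta>\<^sup>2"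
        using sq[OF that(2)] N1[of j i] N2 that by auto
      have "norm (w i x - w j x) \<le> \<eta> / 2 + (w i x - w j x)\<^sup>2 * (1 / (2 * \<eta>))" for x
      proof -
        have "0 \<le> (\<bar>w i x - w j x\<bar> - \<eta>)\<^sup>2" by simp
        then have "2 * \<eta> * \<bar>w i x - w j x\<bar> \<le> \<eta>\<^sup>2 + (w i x - w j x)\<^sup>2"
          by (simp add: power2_diff algebra_simps)
        then show ?thesis using \<eta> by (simp add: field_simps power2_eq_square)
      qed
      then have "(\<integral>x. norm (w i x - w j x) \<partial>M) \<le> (\<integral>x. \<eta> / 2 + (w i x - w j x)\<^sup>2 * (1 / (2 * \<eta>)) \<partial>M)"
        by (intro integral_mono integrable_norm Bochner_Integration.integrable_diff w_int
            Bochner_Integration.integrable_add integrable_mult_left sq_int) auto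
      also have "\<dots> = \<eta> / 2 + (\<integral>x. (w i x - w j x)\<^sup>2 \<partial>M) * (1 / (2 * \<eta>))"
        using sq_int[of i j] by (simp add: prob_space)
      also have "\<dots> \<le> \<eta> / 2 + 3 * \<eta>\<^sup>2 * (1 / (2 * \<eta>))"
        using sq_le \<eta>
        by (intro add_left_mono mult_right_mono) auto
      also have "\<dots> = e / 2" using \<eta> by (simp add: \<eta>_def power2_eq_square)
      finally show ?thesis using that \<open>e > 0\<close> by linarith
    qed
    show ?thesis
    proof (intro exI allI impI)
      fix i j assume "max N1 N2 \<le> i" "max N1 N2 \<le> j"
      moreover have "(\<integral>x. norm (w i x - w j x) \<partial>M) = (\<integral>x. norm (w j x - w i x) \<partial>M)"
        by (simp only: norm_minus_commute)
      ultimately show "(\<integral>x. norm (w i x - w j x) \<partial>M) < e"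
        using *[of i j] *[of j i] by (metis nle_le)
    qed
  qed
  then obtain r where r: "strict_mono r" "AE x in M. Cauchy (\<lambda>i. w (r i) x)"
    by (rule cauchy_L1_AE_cauchy_subseq[OF w_int])
  show ?thesis
  proof (intro exI[of _ "\<lambda>n. v (r n)"] conjI allI)
    show "v (r n) \<in> A n" for n
      using v(1)[of "r n"] antiA[of n "r n"] strict_mono_imp_increasing[OF r(1)] by blast
    show "AE x in M. Cauchy (\<lambda>n. exp (- v (r n) x / 2))" using r(2) by (simp add: w_def)
  qed
qed

text \<open>Boundedness in probability makes the limit of \<open>exp (- u n / 2)\<close> positive almost everywhere, so the
selected functions themselves converge to a finite limit.\<close>

lemma (in prob_space) convergent_selection:
  fixes A :: "nat \<Rightarrow> ('a \<Rightarrow> real) set"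
  assumes dec: "\<And>n. A (Suc n) \<subseteq> A n"
    and ne: "\<And>n. A n \<noteq> {}"
    and meas: "\<And>n f. f \<in> A n \<Longrightarrow> f \<in> borel_measurable M"
    and nonneg: "\<And>n f x. f \<in> A n \<Longrightarrow> 0 \<le> f x"
    and mid: "\<And>n f h. f \<in> A n \<Longrightarrow> h \<in> A n \<Longrightarrow> (\<lambda>x. (f x + h x) / 2) \<in> A n"
    and bdd: "\<And>\<epsilon>. 0 < \<epsilon> \<Longrightarrow> \<exists>l. \<forall>f\<in>A 0. prob {x \<in> space M. l < f x} \<le> \<epsilon>"
  shows "\<exists>u g. (\<forall>n. u n \<in> A n) \<and> g \<in> borel_measurable M \<and> (\<forall>x. 0 \<le> g x) \<and>
    (AE x in M. (\<lambda>n. u n x) \<longlonglongrightarrow> g x)"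
proof -
  obtain u where u: "\<And>n. u n \<in> A n" and C: "AE x in M. Cauchy (\<lambda>n. exp (- u n x / 2))"
  proof (atomize_elim, rule exponential_Cauchy_selection)
  qed (fact dec ne meas nonneg mid)+
  have u0: "u n \<in> A 0" for n
    using u lift_Suc_antimono_le[of A, OF dec, of 0 n] by blast
  have [measurable]: "u n \<in> borel_measurable M" for n using meas u by blast
  define W where "W x = lim (\<lambda>n. exp (- u n x / 2))" for x
  have [measurable]: "W \<in> borel_measurable M" unfolding W_def by measurable
  have W: "AE x in M. (\<lambda>n. exp (- u n x / 2)) \<longlonglongrightarrow> W x"
    using C by eventually_elim (simp add: W_def Cauchy_convergent convergent_LIMSEQ_iff[symmetric])
  let ?Z = "{x \<in> space M. (\<lambda>n. exp (- u n x / 2)) \<longlonglongrightarrow> 0}"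
  have "prob ?Z \<le> \<epsilon>" if "0 < \<epsilon>" for \<epsilon>
  proof -
    obtain l where l: "\<And>f. f \<in> A 0 \<Longrightarrow> prob {x \<in> space M. l < f x} \<le> \<epsilon>" using bdd[OF \<open>0 < \<epsilon>\<close>] by blast
    define T where "T i = {x \<in> space M. \<forall>j\<ge>i. l < u j x}" for i
    have T[measurable]: "T i \<in> sets M" for i unfolding T_def by measurable
    have "incseq T" by (auto simp: incseq_def T_def)
    have "prob (T i) \<le> \<epsilon>" for i
    proof -
      have "prob (T i) \<le> prob {x \<in> space M. l < u i x}"
        by (rule finite_measure_mono) (auto simp: T_def)
      also have "\<dots> \<le> \<epsilon>" using l[OF u0] .
      finally show ?thesis .
    qed
    moreover have "(\<lambda>i. prob (T i)) \<longlonglongrightarrow> prob (\<Union>i. T i)"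
      by (rule finite_Lim_measure_incseq) (use \<open>incseq T\<close> in auto)
    ultimately have "prob (\<Union>i. T i) \<le> \<epsilon>" by (intro LIMSEQ_le_const2) auto
    moreover have "?Z \<subseteq> (\<Union>i. T i)"
    proof
      fix x assume x: "x \<in> ?Z"
      then have "eventually (\<lambda>n. exp (- u n x / 2) < exp (- l / 2)) sequentially"
        by (intro order_tendstoD(2)) auto
      then show "x \<in> (\<Union>i. T i)" using x by (auto simp: eventually_sequentially T_def)
    qed
    moreover have "(\<Union>i. T i) \<in> sets M" by (intro sets.countable_UN) auto
    ultimately show ?thesis using finite_measure_mono by (metis (no_types) order_trans)
  qed
  then have "prob ?Z \<le> 0" by (rule dense_ge)
  then have "AE x in M. x \<notin> ?Z"
    by (intro AE_not_in) (simp add: null_sets_def emeasure_eq_measure measure_le_0_iff)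
  then have "AE x in M. (\<lambda>n. u n x) \<longlonglongrightarrow> max 0 (- 2 * ln (W x))"
    using W AE_space
  proof eventually_elim
    case (elim x)
    have "W x \<ge> 0" by (rule LIMSEQ_le_const[OF elim(2)]) auto
    moreover have "W x \<noteq> 0" using elim by auto
    ultimately have "(\<lambda>n. - 2 * ln (exp (- u n x / 2))) \<longlonglongrightarrow> - 2 * ln (W x)"
      by (intro tendsto_intros elim(2)) auto
    then have *: "(\<lambda>n. u n x) \<longlonglongrightarrow> - 2 * ln (W x)" by simp
    then have "0 \<le> - 2 * ln (W x)" by (rule LIMSEQ_le_const) (use nonneg[OF u] in auto)
    then show ?case using * by (simp add: max_def)
  qed
  then show ?thesis
    using u by (intro exI[of _ u] exI[of _ "\<lambda>x. max 0 (- 2 * ln (W x))"]) auto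
qed

section \<open>Penalised utilities\<close>

text \<open>The penalty charges losses beyond \<open>j + 1\<close> with weight \<open>k j\<close>.  Since the \<open>j\<close>-th term vanishes
on arguments above \<open>- (j + 1)\<close>, adding further terms does not change the utility of a position whose
losses are bounded by \<open>j + 1\<close>.  The weight \<open>a\<close> will be the value of the indicator of an event.\<close>

definition penalty :: "(nat \<Rightarrow> real) \<Rightarrow> nat \<Rightarrow> real \<Rightarrow> real" where
  "penalty k n x = (\<Sum>j<n. k j * (max 0 (- x - real (Suc j)))\<^sup>2)"

definition util :: "real \<Rightarrow> (nat \<Rightarrow> real) \<Rightarrow> nat \<Rightarrow> real \<Rightarrow> real" where
  "util a k n x = a * (1 - exp (- x)) - penalty k n x"

definition marginal :: "real \<Rightarrow> (nat \<Rightarrow> real) \<Rightarrow> nat \<Rightarrow> real \<Rightarrow> real" where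
  "marginal a k n x = a * exp (- x) + (\<Sum>j<n. 2 * k j * max 0 (- x - real (Suc j)))"

text \<open>Bounds the marginal utility at arguments above \<open>- m\<close>, whatever the number of penalty terms.\<close>

definition marginal_cap :: "(nat \<Rightarrow> real) \<Rightarrow> nat \<Rightarrow> real" where
  "marginal_cap k m = exp (real m) + (\<Sum>j<m. 2 * k j * real m)"

lemma util_indicator_measurable [measurable]:
  assumes [measurable]: "A \<in> sets M" "h \<in> borel_measurable M"
  shows "(\<lambda>x. util (indicator A x) k n (h x)) \<in> borel_measurable M"
  unfolding util_def penalty_def by measurable

lemma marginal_indicator_measurable [measurable]:
  assumes [measurable]: "A \<in> sets M" "h \<in> borel_measurable M"
  shows "(\<lambda>x. marginal (indicator A x) k n (h x)) \<in> borel_measurable M"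
  unfolding marginal_def by measurable

lemma marginal_nonneg: "0 \<le> a \<Longrightarrow> (\<And>j. 0 \<le> k j) \<Longrightarrow> 0 \<le> marginal a k n x"
  unfolding marginal_def by (intro add_nonneg_nonneg sum_nonneg mult_nonneg_nonneg) auto

lemma penalty_nonneg: "(\<And>j. 0 \<le> k j) \<Longrightarrow> 0 \<le> penalty k n x"
  unfolding penalty_def by (intro sum_nonneg mult_nonneg_nonneg) auto

lemma penalty_eq_0: "0 \<le> x \<Longrightarrow> penalty k n x = 0"
  unfolding penalty_def by (intro sum.neutral) auto

lemma util_nonneg_arg: "0 \<le> x \<Longrightarrow> util a k n x = a * (1 - exp (- x))"
  by (simp add: util_def penalty_eq_0)

lemma marginal_nonneg_arg: "0 \<le> x \<Longrightarrow> marginal a k n x = a * exp (- x)"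
  unfolding marginal_def by (subst sum.neutral) auto

lemma util_cong: "(\<And>j. j < n \<Longrightarrow> k j = k' j) \<Longrightarrow> util a k n x = util a k' n x"
  unfolding util_def penalty_def by simp

lemma util_Suc:
  "util a (k(n := c)) (Suc n) x = util a k n x - c * (max 0 (- x - real (Suc n)))\<^sup>2"
  unfolding util_def penalty_def by (simp cong: sum.cong_simp)

text \<open>The graph of a concave function lies below its tangents: for the exponential part this is
\<open>1 + u \<le> exp u\<close>, for a penalty term it is the tangent inequality of \<open>u \<mapsto> (max 0 u)\<^sup>2\<close>.\<close>

lemma util_tangent:
  assumes "0 \<le> a" "\<And>j. 0 \<le> k j"
  shows "util a k n z \<le> util a k n x + marginal a k n x * (z - x)"
proof -
  have "a * (1 - exp (- z)) \<le> a * (1 - exp (- x)) + a * exp (- x) * (z - x)"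
  proof -
    have "exp (- x) * (1 + (x - z)) \<le> exp (- x) * exp (x - z)"
      by (intro mult_left_mono exp_ge_add_one_self) auto
    also have "\<dots> = exp (- z)" by (simp add: exp_add[symmetric])
    finally have "1 - exp (- z) \<le> (1 - exp (- x)) + exp (- x) * (z - x)" by (simp add: algebra_simps)
    from mult_left_mono[OF this assms(1)] show ?thesis by (simp add: algebra_simps)
  qed
  moreover have "penalty k n x - (\<Sum>j<n. 2 * k j * max 0 (- x - real (Suc j))) * (z - x) \<le> penalty k n z"
    unfolding penalty_def sum_distrib_right sum_subtractf[symmetric]
  proof (rule sum_mono)
    fix j
    have q: "(max 0 u)\<^sup>2 + 2 * max 0 u * (v - u) \<le> (max 0 v)\<^sup>2" for u v :: real
    proof -
      have "0 \<le> (max 0 v - max 0 u)\<^sup>2" by simp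
      moreover have "max 0 u * v \<le> max 0 u * max 0 v" by (intro mult_left_mono) auto
      moreover have "max 0 u * u = (max 0 u)\<^sup>2" by (auto simp: max_def power2_eq_square)
      ultimately show ?thesis by (simp add: power2_diff algebra_simps)
    qed
    show "k j * (max 0 (- x - real (Suc j)))\<^sup>2 - 2 * k j * max 0 (- x - real (Suc j)) * (z - x)
        \<le> k j * (max 0 (- z - real (Suc j)))\<^sup>2"
      using mult_left_mono[OF q[of "- x - real (Suc j)" "- z - real (Suc j)"] assms(2)[of j]]
      by (simp add: algebra_simps)
  qed
  ultimately show ?thesis unfolding util_def marginal_def by (simp add: algebra_simps)
qed

lemma util_concave:
  assumes "0 \<le> a" "\<And>j. 0 \<le> k j" "0 \<le> t" "t \<le> 1"
  shows "(1 - t) * util a k n x + t * util a k n z \<le> util a k n ((1 - t) * x + t * z)"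
proof -
  let ?w = "(1 - t) * x + t * z"
  note T = util_tangent[of a k n _ ?w, OF assms(1,2)]
  have "(1 - t) * util a k n x + t * util a k n z
      \<le> (1 - t) * (util a k n ?w + marginal a k n ?w * (x - ?w))
        + t * (util a k n ?w + marginal a k n ?w * (z - ?w))"
    by (intro add_mono mult_left_mono T) (use assms in auto)
  also have "\<dots> = util a k n ?w" by (simp add: algebra_simps)
  finally show ?thesis .
qed

lemma util_le_1: "0 \<le> a \<Longrightarrow> a \<le> 1 \<Longrightarrow> (\<And>j. 0 \<le> k j) \<Longrightarrow> util a k n x \<le> 1"
proof -
  assume a: "0 \<le> a" "a \<le> 1" "\<And>j. 0 \<le> k j"
  have "a * (1 - exp (- x)) \<le> a * 1" using a by (intro mult_left_mono) auto
  then show ?thesis using a penalty_nonneg[of k n x] by (simp add: util_def)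
qed

lemma util_bounds:
  assumes a: "0 \<le> a" "a \<le> 1" and k: "\<And>j. 0 \<le> k j" and x: "- N \<le> x" and N: "0 \<le> N"
  shows "\<bar>util a k n x\<bar> \<le> 1 + exp N + penalty k n (- N)"
proof -
  have "util a k n (- N) \<le> util a k n x + marginal a k n x * (- N - x)"
    by (rule util_tangent[OF a(1) k])
  also have "\<dots> \<le> util a k n x"
    using marginal_nonneg[of a k n x, OF a(1) k] x by (simp add: mult_nonneg_nonpos)
  finally have "util a k n (- N) \<le> util a k n x" .
  moreover have "- exp N \<le> a * (1 - exp N)"
  proof -
    have "a * (exp N - 1) \<le> 1 * (exp N - 1)" using a N by (intro mult_right_mono) auto
    then show ?thesis by (simp add: algebra_simps)
  qed
  then have "- exp N - penalty k n (- N) \<le> util a k n (- N)" unfolding util_def by simp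
  ultimately show ?thesis
    using util_le_1[of a k n x, OF a k] penalty_nonneg[of k n "- N", OF k] exp_gt_zero[of N] by linarith
qed

lemma DERIV_util: "(util a k n has_real_derivative marginal a k n x) (at x)"
proof -
  have q: "((\<lambda>u. (max 0 u)\<^sup>2) has_real_derivative 2 * max 0 v) (at v)" for v :: real
  proof -
    consider "v < 0" | "v = 0" | "v > 0" by linarith
    then show ?thesis
    proof cases
      case 1
      have "((\<lambda>u. 0) has_real_derivative 2 * max 0 v) (at v)" using 1 by simp
      then show ?thesis
        by (rule has_field_derivative_transform_within_open[of _ _ _ "{..<0}"]) (use 1 in auto)
    next
      case 3
      have "((\<lambda>u. u\<^sup>2) has_real_derivative 2 * max 0 v) (at v)"
        by (rule derivative_eq_intros refl)+ (use 3 in auto)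
      then show ?thesis
        by (rule has_field_derivative_transform_within_open[of _ _ _ "{0<..}"]) (use 3 in auto)
    next
      case 2
      have "((\<lambda>h. max 0 h) \<longlongrightarrow> max 0 0) (at (0::real))" by (intro tendsto_intros)
      then have "((\<lambda>h. max 0 h) \<longlongrightarrow> 0) (at (0::real))" by simp
      then have "((\<lambda>h. (max 0 h)\<^sup>2 / h) \<longlongrightarrow> 0) (at (0::real))"
        by (rule Lim_transform_eventually)
          (auto simp: eventually_at_filter max_def power2_eq_square)
      then show ?thesis using 2 by (simp add: DERIV_def)
    qed
  qed
  have "((\<lambda>x. k j * (max 0 (- x - real (Suc j)))\<^sup>2) has_real_derivative
      k j * (2 * max 0 (- x - real (Suc j)) * (- 1))) (at x)" for j
    by (intro DERIV_cmult DERIV_chain2[OF q]) (auto intro!: derivative_eq_intros)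
  then have "(penalty k n has_real_derivative
      (\<Sum>j<n. k j * (2 * max 0 (- x - real (Suc j)) * (- 1)))) (at x)"
    unfolding penalty_def by (rule DERIV_sum)
  moreover have "((\<lambda>x. a * (1 - exp (- x))) has_real_derivative a * exp (- x)) (at x)"
    by (auto intro!: derivative_eq_intros)
  ultimately have "(util a k n has_real_derivative
      a * exp (- x) - (\<Sum>j<n. k j * (2 * max 0 (- x - real (Suc j)) * (- 1)))) (at x)"
    unfolding util_def by (intro DERIV_diff)
  then show ?thesis unfolding marginal_def by (simp add: sum_negf mult_ac)
qed

lemma marginal_le_cap:
  assumes "0 \<le> a" "a \<le> 1" "\<And>j. 0 \<le> k j" "- real m \<le> x"
  shows "marginal a k n x \<le> marginal_cap k m"
proof -
  have "a * exp (- x) \<le> 1 * exp (real m)" using assms by (intro mult_mono) auto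
  moreover have "(\<Sum>j<n. 2 * k j * max 0 (- x - real (Suc j))) \<le> (\<Sum>j<m. 2 * k j * real m)"
  proof -
    have "(\<Sum>j<n. 2 * k j * max 0 (- x - real (Suc j)))
        \<le> (\<Sum>j<n. if j \<in> {..<m} then 2 * k j * real m else 0)"
    proof (rule sum_mono)
      fix j
      have "max 0 (- x - real (Suc j)) \<le> (if j < m then real m else 0)"
        using assms(4) by (auto simp: max_def)
      from mult_left_mono[OF this, of "2 * k j"]
      show "2 * k j * max 0 (- x - real (Suc j)) \<le> (if j \<in> {..<m} then 2 * k j * real m else 0)"
        using assms(3)[of j] by (auto split: if_splits)
    qed
    also have "\<dots> = (\<Sum>j\<in>{..<n} \<inter> {..<m}. 2 * k j * real m)" by (rule sum.inter_restrict[symmetric]) simp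
    also have "\<dots> \<le> (\<Sum>j<m. 2 * k j * real m)" by (rule sum_mono2) (use assms(3) in auto)
    finally show ?thesis .
  qed
  ultimately show ?thesis unfolding marginal_def marginal_cap_def by simp
qed

lemma marginal_cap_nonneg: "(\<And>j. 0 \<le> k j) \<Longrightarrow> 0 \<le> marginal_cap k m"
  unfolding marginal_cap_def by (intro add_nonneg_nonneg sum_nonneg mult_nonneg_nonneg) auto

text \<open>On gains only the exponential part is active, and \<open>x * exp (- x) \<le> 1\<close>.\<close>

lemma marginal_times_arg_le_1:
  assumes "0 \<le> a" "a \<le> 1" "\<And>j. 0 \<le> k j"
  shows "marginal a k n x * max 0 x \<le> 1"
proof (cases "0 \<le> x")
  case True
  have "x \<le> exp x" using exp_ge_add_one_self[of x] by linarith
  then have "exp (- x) * x \<le> 1" by (simp add: exp_minus field_simps)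
  then have "a * (exp (- x) * x) \<le> 1 * 1" using assms True by (intro mult_mono) auto
  then show ?thesis using True by (simp add: marginal_nonneg_arg mult.assoc)
qed simp

section \<open>Sets in which the constant one is a candidate numeraire\<close>

text \<open>The situation after division by the candidate numeraire, which has become the constant \<open>1\<close>.
Put \<open>J n = {n * (f - 1) | f \<in> D}\<close>.  Convexity makes these sets increase with \<open>n\<close>, and the
extrapolation property says that an element of any of them that is bounded below by \<open>- m\<close> already
lies in \<open>J m\<close>.\<close>

locale numeraire_set = prob_space M for M :: "'a measure" +
  fixes D :: "('a \<Rightarrow> real) set"
  assumes D_measurable: "f \<in> D \<Longrightarrow> f \<in> borel_measurable M"
    and D_nonneg: "f \<in> D \<Longrightarrow> 0 \<le> f x"
    and D_convex: "f \<in> D \<Longrightarrow> h \<in> D \<Longrightarrow> 0 \<le> t \<Longrightarrow> t \<le> 1 \<Longrightarrow> (\<lambda>x. (1 - t) * f x + t * h x) \<in> D"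
    and D_closed: "(\<And>n. u n \<in> D) \<Longrightarrow> f \<in> borel_measurable M \<Longrightarrow> (\<And>x. 0 \<le> f x) \<Longrightarrow>
      (AE x in M. (\<lambda>n. u n x) \<longlonglongrightarrow> f x) \<Longrightarrow> f \<in> D"
    and D_one: "(\<lambda>x. 1) \<in> D"
    and D_extrapolate: "f \<in> D \<Longrightarrow> 0 \<le> \<delta> \<Longrightarrow> (\<And>x. 0 \<le> (1 + \<delta>) * f x - \<delta>) \<Longrightarrow>
      (\<lambda>x. (1 + \<delta>) * f x - \<delta>) \<in> D"
    and D_bounded: "0 < \<epsilon> \<Longrightarrow> \<exists>l. \<forall>f\<in>D. prob {x \<in> space M. l < f x} \<le> \<epsilon>"
begin

lemma D_selection:
  assumes sub: "\<And>n. A n \<subseteq> D" and dec: "\<And>n. A (Suc n) \<subseteq> A n" and ne: "\<And>n. A n \<noteq> {}"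
    and mid: "\<And>n f h. f \<in> A n \<Longrightarrow> h \<in> A n \<Longrightarrow> (\<lambda>x. (1 - 1/2) * f x + 1/2 * h x) \<in> A n"
  shows "\<exists>u f. (\<forall>n. u n \<in> A n) \<and> f \<in> D \<and> (AE x in M. (\<lambda>n. u n x) \<longlonglongrightarrow> f x)"
proof -
  have mid': "(\<lambda>x. (f x + h x) / 2) \<in> A n" if "f \<in> A n" "h \<in> A n" for n f h
    using mid[OF that] by (simp add: add_divide_distrib)
  have bdd: "\<exists>l. \<forall>f\<in>A 0. prob {x \<in> space M. l < f x} \<le> \<epsilon>" if "0 < \<epsilon>" for \<epsilon>
    using D_bounded[OF that] sub[of 0] by blast
  obtain u g where u: "\<And>n. u n \<in> A n" and g: "g \<in> borel_measurable M" "\<And>x. 0 \<le> g x"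
    "AE x in M. (\<lambda>n. u n x) \<longlonglongrightarrow> g x"
  proof (atomize_elim, rule convergent_selection)
    show "f \<in> borel_measurable M" if "f \<in> A n" for f n using that sub D_measurable by blast
    show "0 \<le> f x" if "f \<in> A n" for f n x using that sub D_nonneg by blast
  qed (fact dec ne mid' bdd)+
  have "u n \<in> D" for n using u sub by blast
  then have "g \<in> D" using g by (rule D_closed)
  then show ?thesis using u g by blast
qed

definition expected_util :: "'a set \<Rightarrow> (nat \<Rightarrow> real) \<Rightarrow> nat \<Rightarrow> real \<Rightarrow> ('a \<Rightarrow> real) \<Rightarrow> real" where
  "expected_util A k n r f = (\<integral>x. util (indicator A x) k n (r * (f x - 1)) \<partial>M)"

context
  fixes A :: "'a set" and k :: "nat \<Rightarrow> real"
  assumes A[measurable]: "A \<in> sets M" and k: "\<And>j. 0 \<le> k j"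
begin

lemma indicator_01: "(0::real) \<le> indicator A x" "indicator A x \<le> (1::real)"
  by (auto simp: indicator_def)

lemma util_D_bound:
  assumes "f \<in> D" "0 \<le> r"
  shows "\<bar>util (indicator A x) k n (r * (f x - 1))\<bar> \<le> 1 + exp r + penalty k n (- r)"
proof (rule util_bounds[OF indicator_01 k])
  have "r * 0 \<le> r * f x" using assms D_nonneg by (intro mult_left_mono) auto
  then show "- r \<le> r * (f x - 1)" by (simp add: algebra_simps)
qed fact

lemma util_integrable:
  assumes "f \<in> D" "0 \<le> r"
  shows "integrable M (\<lambda>x. util (indicator A x) k n (r * (f x - 1)))"
  using util_D_bound[OF assms] D_measurable[OF assms(1)]
  by (intro integrable_const_bound[where B="1 + exp r + penalty k n (- r)"]) auto

lemma expected_util_tendsto: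
  assumes u: "\<And>n. u n \<in> D" and f: "f \<in> D" and lim: "AE x in M. (\<lambda>n. u n x) \<longlonglongrightarrow> f x" and r: "0 \<le> r"
  shows "(\<lambda>i. expected_util A k n r (u i)) \<longlonglongrightarrow> expected_util A k n r f"
  unfolding expected_util_def
proof (rule integral_dominated_convergence[where w="\<lambda>x. 1 + exp r + penalty k n (- r)"])
  have [measurable]: "f \<in> borel_measurable M" "u i \<in> borel_measurable M" for i
    using D_measurable u f by auto
  show "(\<lambda>x. util (indicator A x) k n (r * (f x - 1))) \<in> borel_measurable M"
    and "(\<lambda>x. util (indicator A x) k n (r * (u i x - 1))) \<in> borel_measurable M" for i by measurable
  show "AE x in M. (\<lambda>i. util (indicator A x) k n (r * (u i x - 1)))
      \<longlonglongrightarrow> util (indicator A x) k n (r * (f x - 1))"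
    using lim
  proof eventually_elim
    case (elim x)
    show ?case
      by (rule isCont_tendsto_compose[OF DERIV_isCont[OF DERIV_util]]) (intro tendsto_intros elim)
  qed
  show "AE x in M. norm (util (indicator A x) k n (r * (u i x - 1))) \<le> 1 + exp r + penalty k n (- r)" for i
    using util_D_bound[OF u r] by auto
qed simp

lemma expected_util_concave:
  assumes "f \<in> D" "h \<in> D" "0 \<le> t" "t \<le> 1" "0 \<le> r"
  shows "(1 - t) * expected_util A k n r f + t * expected_util A k n r h
    \<le> expected_util A k n r (\<lambda>x. (1 - t) * f x + t * h x)"
proof -
  note int = util_integrable[OF _ assms(5)]
  have "(1 - t) * expected_util A k n r f + t * expected_util A k n r h
    = (\<integral>x. (1 - t) * util (indicator A x) k n (r * (f x - 1))
        + t * util (indicator A x) k n (r * (h x - 1)) \<partial>M)"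
    unfolding expected_util_def using int[OF assms(1)] int[OF assms(2)] by simp
  also have "\<dots> \<le> expected_util A k n r (\<lambda>x. (1 - t) * f x + t * h x)"
    unfolding expected_util_def
  proof (rule integral_mono)
    show "integrable M (\<lambda>x. util (indicator A x) k n (r * ((1 - t) * f x + t * h x - 1)))"
      by (rule int[OF D_convex[OF assms(1-4)]])
    show "(1 - t) * util (indicator A x) k n (r * (f x - 1)) + t * util (indicator A x) k n (r * (h x - 1))
      \<le> util (indicator A x) k n (r * ((1 - t) * f x + t * h x - 1))" for x
    proof -
      have "r * ((1 - t) * f x + t * h x - 1) = (1 - t) * (r * (f x - 1)) + t * (r * (h x - 1))"
        by (simp add: algebra_simps)
      then show ?thesis using util_concave[of "indicator A x" k t, OF indicator_01(1) k assms(3,4)] by simp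
    qed
  qed (use int assms in auto)
  finally show ?thesis .
qed

lemma expected_util_le_1: "f \<in> D \<Longrightarrow> 0 \<le> r \<Longrightarrow> expected_util A k n r f \<le> 1"
proof -
  assume "f \<in> D" "0 \<le> r"
  then have "expected_util A k n r f \<le> (\<integral>x. 1 \<partial>M)"
    unfolding expected_util_def
    by (intro integral_mono util_integrable) (auto intro!: util_le_1 indicator_01 k)
  then show ?thesis by (simp add: prob_space)
qed

text \<open>By concavity the approximate maximisers form convex sets.  As positions in \<open>J r\<close> are bounded below by
\<open>- r\<close>, expected utility is continuous along the sequence selected from them.\<close>

lemma expected_util_maximiser:
  assumes r: "0 \<le> r"
  shows "\<exists>f\<in>D. \<forall>h\<in>D. expected_util A k n r h \<le> expected_util A k n r f"
proof -
  let ?E = "expected_util A k n r"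
  define S where "S = (SUP f\<in>D. ?E f)"
  have bdd: "bdd_above (?E ` D)" using expected_util_le_1[OF _ r] by (auto intro!: bdd_aboveI[of _ 1])
  have le_S: "?E f \<le> S" if "f \<in> D" for f unfolding S_def by (rule cSUP_upper[OF that bdd])
  define B where "B j = {f \<in> D. S - 1 / real (Suc j) \<le> ?E f}" for j
  have "\<exists>u f. (\<forall>n. u n \<in> B n) \<and> f \<in> D \<and> (AE x in M. (\<lambda>n. u n x) \<longlonglongrightarrow> f x)"
  proof (rule D_selection)
    show "B j \<subseteq> D" for j by (auto simp: B_def)
    show "B (Suc j) \<subseteq> B j" for j
    proof -
      have "S - 1 / real (Suc j) \<le> S - 1 / real (Suc (Suc j))" by (intro diff_left_mono frac_le) auto
      then show ?thesis unfolding B_def by (auto simp del: of_nat_Suc)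
    qed
    show "B j \<noteq> {}" for j
    proof -
      have "S - 1 / real (Suc j) < (SUP f\<in>D. ?E f)" by (simp add: S_def)
      then have "\<exists>f\<in>D. S - 1 / real (Suc j) < ?E f" using less_cSUP_iff[OF _ bdd] D_one by blast
      then show ?thesis unfolding B_def by force
    qed
    show "(\<lambda>x. (1 - 1/2) * f x + 1/2 * h x) \<in> B j" if "f \<in> B j" "h \<in> B j" for f h j
      using that expected_util_concave[of f h "1/2" r n, OF _ _ _ _ r] D_convex[of f h "1/2"]
      by (auto simp: B_def)
  qed
  then obtain u f where u: "\<And>n. u n \<in> B n" and f: "f \<in> D" and lim: "AE x in M. (\<lambda>n. u n x) \<longlonglongrightarrow> f x"
    by blast
  have uD: "u n \<in> D" for n using u by (auto simp: B_def)
  have "S \<le> ?E f"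
  proof (rule LIMSEQ_le)
    show "(\<lambda>i. ?E (u i)) \<longlonglongrightarrow> ?E f" by (rule expected_util_tendsto[OF uD f lim r])
    have "(\<lambda>j. S - 1 / real (Suc j)) \<longlonglongrightarrow> S - 0"
      by (intro tendsto_diff tendsto_const LIMSEQ_Suc lim_1_over_n)
    then show "(\<lambda>j. S - 1 / real (Suc j)) \<longlonglongrightarrow> S" by simp
    show "\<exists>N. \<forall>n\<ge>N. S - 1 / real (Suc n) \<le> ?E (u n)" using u by (auto simp: B_def)
  qed
  then show ?thesis using f le_S by (meson order_trans)
qed

lemma expected_util_Suc:
  assumes "f \<in> D" "0 \<le> r"
  shows "expected_util A (k(n := c)) (Suc n) r f = expected_util A (k(n := 0)) (Suc n) r f
    - c * (\<integral>x. (max 0 (- r * (f x - 1) - real (Suc n)))\<^sup>2 \<partial>M)"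
proof -
  have [measurable]: "f \<in> borel_measurable M" using assms D_measurable by auto
  have "0 \<le> r * f x" for x using D_nonneg[OF assms(1)] assms(2) by simp
  then have "norm ((max 0 (- r * (f x - 1) - real (Suc n)))\<^sup>2) \<le> r\<^sup>2" for x
    using assms(2) by (auto simp: algebra_simps intro!: power_mono)
  then have int: "integrable M (\<lambda>x. (max 0 (- r * (f x - 1) - real (Suc n)))\<^sup>2)"
    by (intro integrable_const_bound[where B="r\<^sup>2"]) auto
  have int': "integrable M (\<lambda>x. util (indicator A x) k n (r * (f x - 1)))"
    by (rule util_integrable[OF assms])
  show ?thesis
    unfolding expected_util_def util_Suc using int int' by simp
qed

end

text \<open>A large enough penalty on losses beyond \<open>n + 1\<close> makes the larger set \<open>J (n + 2)\<close> of positions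
almost useless in comparison with \<open>J (n + 1)\<close>.  Otherwise there would be, for every weight \<open>c\<close>, a position of
utility above \<open>V'\<close>; a limit of such positions has utility at least \<open>V'\<close> under every
weight, hence suffers no loss beyond \<open>n + 1\<close>, hence lies in \<open>J (n + 1)\<close> by extrapolation, where the
utility is at most \<open>V\<close>.\<close>

lemma penalty_weight_exists:
  assumes A[measurable]: "A \<in> sets M" and k: "\<And>j. 0 \<le> k j"
    and V: "\<And>f. f \<in> D \<Longrightarrow> expected_util A k n (Suc n) f \<le> V" and "V < V'"
  shows "\<exists>c\<ge>0. \<forall>f\<in>D. expected_util A (k(n := c)) (Suc n) (Suc (Suc n)) f \<le> V'"
proof (rule ccontr)
  define r where "r = real (Suc (Suc n))"
  have r: "0 \<le> r" "r = real n + 2" by (simp_all add: r_def)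
  let ?E = "\<lambda>c. expected_util A (k(n := c)) (Suc n) r"
  define P where "P f = (\<integral>x. (max 0 (- r * (f x - 1) - real (Suc n)))\<^sup>2 \<partial>M)" for f
  assume "\<not> ?thesis"
  then have bad: "\<exists>f\<in>D. V' < ?E c f" if "0 \<le> c" for c
    unfolding r_def using that by (meson not_le)
  have P_nonneg: "0 \<le> P f" for f unfolding P_def by (rule Bochner_Integration.integral_nonneg) simp
  have E: "?E c f = ?E 0 f - c * P f" if "f \<in> D" "0 \<le> c" for f c
    unfolding P_def by (rule expected_util_Suc[OF A k that(1) r(1)])
  define B where "B j = {f \<in> D. V' \<le> ?E (real j) f}" for j :: nat
  have "\<exists>u f. (\<forall>n. u n \<in> B n) \<and> f \<in> D \<and> (AE x in M. (\<lambda>n. u n x) \<longlonglongrightarrow> f x)"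
  proof (rule D_selection)
    show "B j \<subseteq> D" for j by (auto simp: B_def)
    show "B (Suc j) \<subseteq> B j" for j
    proof
      fix f assume f: "f \<in> B (Suc j)"
      then have "?E (real (Suc j)) f \<le> ?E (real j) f"
        using P_nonneg[of f] E[of f "real (Suc j)"] E[of f "real j"] by (simp add: B_def algebra_simps)
      then show "f \<in> B j" using f by (auto simp: B_def)
    qed
    show "B j \<noteq> {}" for j using bad[of "real j"] by (force simp: B_def)
    show "(\<lambda>x. (1 - 1/2) * f x + 1/2 * h x) \<in> B j" if fh: "f \<in> B j" "h \<in> B j" for f h j
    proof -
      have "0 \<le> (k(n := real j)) i" for i using k by simp
      then have "(1 - 1/2) * ?E (real j) f + 1/2 * ?E (real j) h \<le> ?E (real j) (\<lambda>x. (1 - 1/2) * f x + 1/2 * h x)"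
        using fh r(1) A by (intro expected_util_concave) (auto simp: B_def)
      then show ?thesis using fh D_convex[of f h "1/2"] by (auto simp: B_def)
    qed
  qed
  then obtain u f where u: "\<And>n. u n \<in> B n" and f: "f \<in> D" and lim: "AE x in M. (\<lambda>n. u n x) \<longlonglongrightarrow> f x"
    by blast
  have uD: "u n \<in> D" for n using u by (auto simp: B_def)
  have V'_le: "V' \<le> ?E (real c) f" for c :: nat
  proof (rule LIMSEQ_le_const)
    show "(\<lambda>i. ?E (real c) (u i)) \<longlonglongrightarrow> ?E (real c) f"
      using k r(1) by (intro expected_util_tendsto[OF A _ uD f lim]) auto
    have "V' \<le> ?E (real c) (u i)" if "c \<le> i" for i
    proof -
      have "V' \<le> ?E (real i) (u i)" using u by (auto simp: B_def)
      also have "\<dots> \<le> ?E (real c) (u i)"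
        using E[OF uD, of "real i" i] E[OF uD, of "real c" i] P_nonneg[of "u i"] that
        by (simp add: mult_right_mono)
      finally show ?thesis .
    qed
    then show "\<exists>N. \<forall>i\<ge>N. V' \<le> ?E (real c) (u i)" by blast
  qed
  have "P f = 0"
  proof (rule ccontr)
    assume "P f \<noteq> 0"
    then have "0 < P f" using P_nonneg[of f] by linarith
    then obtain c :: nat where "?E 0 f - V' < real c * P f" using reals_Archimedean3 by blast
    then show False using V'_le[of c] E[OF f, of "real c"] by simp
  qed
  have [measurable]: "f \<in> borel_measurable M" using f D_measurable by auto
  have "AE x in M. (max 0 (- r * (f x - 1) - real (Suc n)))\<^sup>2 = 0"
  proof -
    have "0 \<le> r * f x" for x using D_nonneg[OF f] r(1) by simp
    then have "norm ((max 0 (- r * (f x - 1) - real (Suc n)))\<^sup>2) \<le> r\<^sup>2" for x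
      using r(1) by (auto simp: algebra_simps intro!: power_mono)
    then have "integrable M (\<lambda>x. (max 0 (- r * (f x - 1) - real (Suc n)))\<^sup>2)"
      by (intro integrable_const_bound[where B="r\<^sup>2"]) auto
    then show ?thesis using integral_nonneg_eq_0_iff_AE[of M "\<lambda>x. (max 0 (- r * (f x - 1) - real (Suc n)))\<^sup>2"]
        \<open>P f = 0\<close> by (auto simp: P_def)
  qed
  then have lower: "AE x in M. 1 / r \<le> f x"
  proof eventually_elim
    case (elim x)
    then have "- r * (f x - 1) \<le> real (Suc n)" by (auto simp: max_def split: if_splits)
    then have "1 \<le> r * f x" using r by (simp add: algebra_simps)
    then show ?case using r by (simp add: field_simps)
  qed
  \<comment> \<open>a version of \<open>f\<close> satisfying the lower bound everywhere, as the extrapolation property demands\<close>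
  define f0 where "f0 x = max (f x) (1 / r)" for x
  have f0: "f0 \<in> D"
  proof (rule D_closed[of "\<lambda>_. f"])
    show "AE x in M. (\<lambda>n. f x) \<longlonglongrightarrow> f0 x" using lower
      by eventually_elim (simp add: f0_def max_absorb1)
    show "f0 \<in> borel_measurable M" unfolding f0_def by measurable
    show "0 \<le> f0 x" for x using D_nonneg[OF f] by (simp add: f0_def max.coboundedI1)
  qed (rule f)
  \<comment> \<open>\<open>(n + 1) * (1 + \<delta>) = n + 2\<close> turns a position scaled by \<open>n + 2\<close> into one scaled by \<open>n + 1\<close>\<close>
  define \<delta> where "\<delta> = 1 / real (Suc n)"
  have \<delta>: "0 \<le> \<delta>" "real (Suc n) * (1 + \<delta>) = r" "(1 + \<delta>) * (1 / r) = \<delta>"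
    using r(2) by (simp_all add: \<delta>_def field_simps)
  define f1 where "f1 = (\<lambda>x. (1 + \<delta>) * f0 x - \<delta>)"
  have f1: "f1 \<in> D" unfolding f1_def
  proof (rule D_extrapolate[OF f0 \<delta>(1)])
    fix x
    have "(1 + \<delta>) * (1 / r) \<le> (1 + \<delta>) * f0 x" using \<delta>(1) by (intro mult_left_mono) (auto simp: f0_def)
    then show "0 \<le> (1 + \<delta>) * f0 x - \<delta>" using \<delta>(3) by simp
  qed
  have "?E 0 f = expected_util A k n (Suc n) f1"
    unfolding expected_util_def
  proof (rule integral_cong_AE)
    have [measurable]: "f1 \<in> borel_measurable M" using f1 D_measurable by auto
    show "(\<lambda>x. util (indicator A x) (k(n := 0)) (Suc n) (r * (f x - 1))) \<in> borel_measurable M"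
      "(\<lambda>x. util (indicator A x) k n (real (Suc n) * (f1 x - 1))) \<in> borel_measurable M" by measurable
    show "AE x in M. util (indicator A x) (k(n := 0)) (Suc n) (r * (f x - 1))
      = util (indicator A x) k n (real (Suc n) * (f1 x - 1))"
      using lower
    proof eventually_elim
      case (elim x)
      have "real (Suc n) * (f1 x - 1) = real (Suc n) * (1 + \<delta>) * (f0 x - 1)"
        by (simp add: f1_def algebra_simps)
      then have "real (Suc n) * (f1 x - 1) = r * (f x - 1)"
        using elim \<delta>(2) by (simp add: f0_def max_absorb1)
      then show ?case by (simp add: util_Suc)
    qed
  qed
  then show False using V[OF f1] V'_le[of 0] \<open>V < V'\<close> by simp
qed

text \<open>Since \<open>D\<close> is bounded in probability, its elements stay below a common level on half of \<open>A\<close>, so the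
supremum \<open>prob A\<close> of the utility is not approached.\<close>

lemma expected_util_base:
  assumes A[measurable]: "A \<in> sets M" and pos: "0 < prob A"
  shows "\<exists>\<alpha><prob A. \<forall>f\<in>D. expected_util A k 0 1 f \<le> \<alpha>"
proof -
  obtain l where l: "\<And>f. f \<in> D \<Longrightarrow> prob {x \<in> space M. l < f x} \<le> prob A / 2"
    using D_bounded[of "prob A / 2"] pos by auto
  define \<alpha> where "\<alpha> = prob A - exp (1 - l) * (prob A / 2)"
  have "expected_util A k 0 1 f \<le> \<alpha>" if f: "f \<in> D" for f
  proof -
    have [measurable]: "f \<in> borel_measurable M" using f D_measurable by auto
    let ?G = "A \<inter> {x \<in> space M. f x \<le> l}"
    have "expected_util A k 0 1 f = (\<integral>x. indicator A x * (1 - exp (1 - f x)) \<partial>M)"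
      by (simp add: expected_util_def util_def penalty_def)
    also have "\<dots> \<le> (\<integral>x. indicator A x - exp (1 - l) * indicator ?G x \<partial>M)"
    proof (rule integral_mono)
      have b: "\<bar>1 - exp (1 - f x)\<bar> \<le> 1 + exp 1" for x
      proof -
        have "exp (1 - f x) \<le> exp 1" using D_nonneg[OF f] by simp
        then show ?thesis using exp_gt_zero[of "1 - f x"] by linarith
      qed
      show "integrable M (\<lambda>x. indicator A x * (1 - exp (1 - f x)))"
        by (rule integrable_const_bound[where B="1 + exp 1"]) (use b in \<open>auto simp: indicator_def intro: add_nonneg_nonneg\<close>)
      show "integrable M (\<lambda>x. indicator A x - exp (1 - l) * indicator ?G x)"
        by (intro Bochner_Integration.integrable_diff integrable_mult_right integrable_real_indicator)
          (auto simp: emeasure_eq_measure)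
      show "indicator A x * (1 - exp (1 - f x)) \<le> indicator A x - exp (1 - l) * indicator ?G x" for x
        by (auto simp: indicator_def)
    qed
    also have "\<dots> = prob A - exp (1 - l) * prob ?G"
      by (subst Bochner_Integration.integral_diff) (auto simp: emeasure_eq_measure)
    also have "\<dots> \<le> \<alpha>"
    proof -
      have "prob A \<le> prob ?G + prob {x \<in> space M. l < f x}"
      proof -
        have "prob A \<le> prob (?G \<union> {x \<in> space M. l < f x})"
          using sets.sets_into_space[OF A] by (intro finite_measure_mono) auto
        also have "\<dots> \<le> prob ?G + prob {x \<in> space M. l < f x}" by (intro measure_subadditive) auto
        finally show ?thesis .
      qed
      then have "prob A / 2 \<le> prob ?G" using l[OF f] by simp
      then show ?thesis by (simp add: \<alpha>_def)
    qed
    finally show ?thesis .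
  qed
  moreover have "\<alpha> < prob A" using pos by (simp add: \<alpha>_def)
  ultimately show ?thesis by blast
qed

text \<open>The weights are chosen one after the other, the \<open>n\<close>-th one raising the bound by no more than
\<open>(\<beta> - \<alpha>) / 2 ^ (n + 1)\<close>.\<close>

lemma bounded_utility_family:
  assumes A: "A \<in> sets M" and pos: "0 < prob A"
  shows "\<exists>k \<beta>. (\<forall>j. 0 \<le> k j) \<and> \<beta> < prob A \<and> (\<forall>n. \<forall>f\<in>D. expected_util A k n (Suc n) f \<le> \<beta>)"
proof -
  obtain \<alpha> where \<alpha>: "\<alpha> < prob A" "\<And>f. f \<in> D \<Longrightarrow> expected_util A (\<lambda>_. 0) 0 1 f \<le> \<alpha>"
    using expected_util_base[OF A pos] by blast
  define \<beta> where "\<beta> = (\<alpha> + prob A) / 2"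
  have \<beta>: "\<alpha> < \<beta>" "\<beta> < prob A" using \<alpha>(1) by (auto simp: \<beta>_def)
  define V where "V n = \<beta> - (\<beta> - \<alpha>) / 2 ^ n" for n :: nat
  have V_Suc: "V n < V (Suc n)" for n using \<beta>(1) by (simp add: V_def field_simps)
  have V_le: "V n \<le> \<beta>" for n using \<beta>(1) by (simp add: V_def)
  let ?P = "\<lambda>n k. (\<forall>j. 0 \<le> k j) \<and> (\<forall>f\<in>D. expected_util A k n (Suc n) f \<le> V n)"
  have "\<exists>K. \<forall>n. ?P n (K n) \<and> (\<forall>j<n. K (Suc n) j = K n j)"
  proof (rule dependent_nat_choice)
    show "\<exists>k. ?P 0 k" using \<alpha>(2) by (intro exI[of _ "\<lambda>_. 0"]) (simp add: V_def)
  next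
    fix k n assume k: "?P n k"
    then obtain c where "0 \<le> c" "\<And>f. f \<in> D \<Longrightarrow> expected_util A (k(n := c)) (Suc n) (Suc (Suc n)) f \<le> V (Suc n)"
      using penalty_weight_exists[OF A, of k n "V n" "V (Suc n)"] V_Suc by blast
    then show "\<exists>k'. ?P (Suc n) k' \<and> (\<forall>j<n. k' j = k j)" using k
      by (intro exI[of _ "k(n := c)"]) auto
  qed
  then obtain K where K: "\<And>n j. 0 \<le> K n j" "\<And>n f. f \<in> D \<Longrightarrow> expected_util A (K n) n (Suc n) f \<le> V n"
    and agree: "\<And>n j. j < n \<Longrightarrow> K (Suc n) j = K n j" by blast
  define k where "k j = K (Suc j) j" for j
  have eq: "k j = K n j" if "j < n" for j n
    using that
  proof (induction n)
    case (Suc n)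
    then show ?case using agree[of j n] by (cases "j = n") (auto simp: k_def)
  qed simp
  have "expected_util A k n (Suc n) f \<le> \<beta>" if "f \<in> D" for n f
  proof -
    have "expected_util A k n (Suc n) f = expected_util A (K n) n (Suc n) f"
      unfolding expected_util_def by (intro Bochner_Integration.integral_cong refl util_cong eq)
    then show ?thesis using K(2)[OF that, of n] V_le[of n] by linarith
  qed
  moreover have "0 \<le> k j" for j by (simp add: k_def K)
  ultimately show ?thesis using \<beta>(2) by blast
qed

text \<open>The difference quotients of the utility along the segment from a maximiser \<open>f\<close> to \<open>h\<close> have
nonpositive expectation, and by concavity they dominate the difference of the utilities at the end
points; Fatou's lemma passes to the derivative.\<close>

lemma first_order_condition:
  assumes A[measurable]: "A \<in> sets M" and k: "\<And>j. 0 \<le> k j" and r: "0 < r" and f: "f \<in> D"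
    and opt: "\<And>h. h \<in> D \<Longrightarrow> expected_util A k n r h \<le> expected_util A k n r f" and h: "h \<in> D"
  shows "integrable M (\<lambda>x. marginal (indicator A x) k n (r * (f x - 1)) * (r * (h x - f x)))"
    "(\<integral>x. marginal (indicator A x) k n (r * (f x - 1)) * (r * (h x - f x)) \<partial>M) \<le> 0"
proof -
  have [measurable]: "f \<in> borel_measurable M" "h \<in> borel_measurable M" using D_measurable f h by auto
  let ?U = "\<lambda>f x. util (indicator A x) k n (r * (f x - 1))"
  have int: "integrable M (?U h)" if "h \<in> D" for h using that r by (intro util_integrable A k) auto
  define t where "t i = 1 / real (Suc i)" for i
  have t: "0 < t i" "t i \<le> 1" for i by (auto simp: t_def)
  define z where "z i = (\<lambda>x. (1 - t i) * f x + t i * h x)" for i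
  have z: "z i \<in> D" for i unfolding z_def by (rule D_convex[OF f h]) (use t[of i] in auto)
  let ?L = "\<lambda>x. ?U h x - ?U f x"
  let ?v = "\<lambda>i x. (?U (z i) x - ?U f x) / t i - ?L x"
  let ?w = "\<lambda>x. marginal (indicator A x) k n (r * (f x - 1)) * (r * (h x - f x)) - ?L x"
  have L_int: "integrable M ?L" using int[OF f] int[OF h] by simp
  have 1: "integrable M (?v i)" for i
    using int[OF f] int[OF z] int[OF h] by (intro Bochner_Integration.integrable_diff integrable_divide) auto
  have 2: "0 \<le> ?v i x" for i x
  proof -
    have "r * (z i x - 1) = (1 - t i) * (r * (f x - 1)) + t i * (r * (h x - 1))"
      by (simp add: z_def algebra_simps)
    then have "(1 - t i) * ?U f x + t i * ?U h x \<le> ?U (z i) x"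
      using util_concave[of "indicator A x" k "t i" n "r * (f x - 1)" "r * (h x - 1)"] k t[of i] by simp
    then show ?thesis using t[of i] by (simp add: field_simps)
  qed
  have 3: "(\<integral>x. ?v i x \<partial>M) \<le> - (\<integral>x. ?L x \<partial>M)" for i
  proof -
    have "(\<integral>x. ?v i x \<partial>M) = (expected_util A k n r (z i) - expected_util A k n r f) / t i - (\<integral>x. ?L x \<partial>M)"
      unfolding expected_util_def using int[OF f] int[OF h] int[OF z[of i]] by simp
    also have "\<dots> \<le> - (\<integral>x. ?L x \<partial>M)" using opt[OF z[of i]] t[of i] by (simp add: divide_nonpos_pos)
    finally show ?thesis .
  qed
  have 4: "(\<lambda>i. ?v i x) \<longlonglongrightarrow> ?w x" for x
  proof -
    let ?\<phi> = "\<lambda>s. util (indicator A x) k n (r * (f x - 1) + s * (r * (h x - f x)))"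
    have "(?\<phi> has_real_derivative marginal (indicator A x) k n (r * (f x - 1) + 0 * (r * (h x - f x)))
        * (r * (h x - f x))) (at 0)"
      by (rule DERIV_chain2[OF DERIV_util]) (auto intro!: derivative_eq_intros)
    then have "((\<lambda>s. (?\<phi> (0 + s) - ?\<phi> 0) / s) \<longlongrightarrow> marginal (indicator A x) k n (r * (f x - 1)) * (r * (h x - f x))) (at 0)"
      by (simp add: DERIV_def)
    moreover have "filterlim t (at 0) sequentially"
      unfolding filterlim_at using t LIMSEQ_Suc[OF lim_1_over_n]
      by (auto simp: t_def[abs_def] simp del: of_nat_Suc)
    ultimately have "(\<lambda>i. (?\<phi> (0 + t i) - ?\<phi> 0) / t i) \<longlonglongrightarrow> marginal (indicator A x) k n (r * (f x - 1)) * (r * (h x - f x))"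
      by (rule filterlim_compose)
    moreover have "r * (f x - 1) + t i * (r * (h x - f x)) = r * (z i x - 1)" for i
      by (simp add: z_def algebra_simps)
    ultimately have "(\<lambda>i. (?U (z i) x - ?U f x) / t i) \<longlonglongrightarrow> marginal (indicator A x) k n (r * (f x - 1)) * (r * (h x - f x))"
      by simp
    then show ?thesis by (rule tendsto_diff) (rule tendsto_const)
  qed
  have 5: "?w \<in> borel_measurable M" by measurable
  have w: "integrable M ?w" "(\<integral>x. ?w x \<partial>M) \<le> - (\<integral>x. ?L x \<partial>M)"
    using Fatou_integral_le[of M ?v _ ?w, OF 1 _ 3 5] 2 4 by auto
  from Bochner_Integration.integrable_add[OF w(1) L_int]
  show "integrable M (\<lambda>x. marginal (indicator A x) k n (r * (f x - 1)) * (r * (h x - f x)))" by simp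
  then show "(\<integral>x. marginal (indicator A x) k n (r * (f x - 1)) * (r * (h x - f x)) \<partial>M) \<le> 0"
    using w L_int by (subst (asm) Bochner_Integration.integral_diff) auto
qed

end

section \<open>Separating densities\<close>

context numeraire_set
begin

text \<open>The density is the marginal utility \<open>y\<close> at a maximiser \<open>h\<close> of the expected utility over \<open>J (n + 1)\<close>.
The first-order condition compares \<open>h\<close> with \<open>0\<close>, which gives \<open>E[y * h] \<ge> 0\<close>, and with
\<open>(n + 1) * (f - 1)\<close>, which gives \<open>E[y * (f - 1)] \<le> E[y * h] / (n + 1) \<le> 1 / (n + 1)\<close>.  The first
of these also controls the excess of \<open>y\<close>: a large marginal utility forces a large
loss, while \<open>E[y * max 0 (- h)] \<le> E[y * max 0 h] \<le> 1\<close>.  The tangent at \<open>h\<close>, evaluated at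
\<open>l * indicator A\<close>, bounds the mass that \<open>y\<close> puts on \<open>A\<close> from below.\<close>

lemma approximate_density:
  assumes A[measurable]: "A \<in> sets M" and k: "\<And>j. 0 \<le> k j"
    and \<beta>: "\<And>f. f \<in> D \<Longrightarrow> expected_util A k n (Suc n) f \<le> \<beta>" and l: "0 < l"
  obtains y where "y \<in> borel_measurable M" "\<And>x. 0 \<le> y x"
    "ennreal ((prob A * (1 - exp (- l)) - \<beta>) / l) \<le> (\<integral>\<^sup>+x. ennreal (y x) * indicator A x \<partial>M)"
    "\<And>m. (\<integral>\<^sup>+x. ennreal (y x - marginal_cap k (Suc m)) \<partial>M) \<le> ennreal (1 / real (Suc m))"
    "\<And>f. f \<in> D \<Longrightarrow> (\<integral>\<^sup>+x. ennreal (y x) * ennreal (f x) \<partial>M)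
       \<le> (\<integral>\<^sup>+x. ennreal (y x) \<partial>M) + ennreal (1 / real (Suc n))"
proof -
  define r where "r = real (Suc n)"
  have r: "0 < r" by (simp add: r_def)
  obtain f0 where f0: "f0 \<in> D" and opt: "\<And>h. h \<in> D \<Longrightarrow> expected_util A k n r h \<le> expected_util A k n r f0"
    using expected_util_maximiser[of A k r n, OF A k less_imp_le[OF r]] by blast
  define h where "h x = r * (f0 x - 1)" for x
  define y where "y x = marginal (indicator A x) k n (h x)" for x
  have [measurable]: "f0 \<in> borel_measurable M" using f0 D_measurable by auto
  have h_meas[measurable]: "h \<in> borel_measurable M" unfolding h_def by measurable
  have y_meas[measurable]: "y \<in> borel_measurable M" unfolding y_def by measurable
  have y_nonneg: "0 \<le> y x" for x unfolding y_def by (intro marginal_nonneg k) simp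
  have h_ge: "- r \<le> h x" for x
  proof -
    have "0 \<le> r * f0 x" using r D_nonneg[OF f0] by simp
    then show ?thesis by (simp add: h_def algebra_simps)
  qed
  have y_cap: "y x \<le> marginal_cap k m" if "- real m \<le> h x" for x m
    unfolding y_def using that k by (intro marginal_le_cap) (auto simp: indicator_def)
  have y_le: "y x \<le> marginal_cap k (Suc n)" for x using h_ge[of x] by (intro y_cap) (simp add: r_def)
  have yp: "y x * max 0 (h x) \<le> 1" for x
    unfolding y_def using k by (intro marginal_times_arg_le_1) (auto simp: indicator_def)
  have ym_le: "y x * max 0 (- h x) \<le> marginal_cap k (Suc n) * r" for x
    using y_le[of x] h_ge[of x] r y_nonneg[of x] marginal_cap_nonneg[OF k] by (intro mult_mono) auto
  have y_int: "integrable M y"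
    by (rule integrable_const_bound[where B="marginal_cap k (Suc n)"]) (use y_le y_nonneg in auto)
  have yp_int: "integrable M (\<lambda>x. y x * max 0 (h x))"
    by (rule integrable_const_bound[where B=1]) (use yp y_nonneg in auto)
  have ym_int: "integrable M (\<lambda>x. y x * max 0 (- h x))"
    by (rule integrable_const_bound[where B="marginal_cap k (Suc n) * r"]) (use ym_le y_nonneg in auto)
  have split: "y x * h x = y x * max 0 (h x) - y x * max 0 (- h x)" for x
    by (auto simp: max_def)
  have yh_int: "integrable M (\<lambda>x. y x * h x)" unfolding split using yp_int ym_int by simp
  have foc: "integrable M (\<lambda>x. y x * (r * (f x - f0 x)))" "(\<integral>x. y x * (r * (f x - f0 x)) \<partial>M) \<le> 0" if "f \<in> D" for f
    unfolding y_def h_def using first_order_condition[OF A k r f0 opt that] by auto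
  have yh_nonneg: "0 \<le> (\<integral>x. y x * h x \<partial>M)"
  proof -
    have "(\<integral>x. y x * h x \<partial>M) = - (\<integral>x. y x * (r * (1 - f0 x)) \<partial>M)"
      by (subst Bochner_Integration.integral_minus[symmetric]) (simp add: h_def algebra_simps)
    then show ?thesis using foc(2)[OF D_one] by simp
  qed
  have yp_le: "(\<integral>x. y x * max 0 (h x) \<partial>M) \<le> 1"
    using integral_mono[OF yp_int, of "\<lambda>_. 1"] yp by (simp add: prob_space)
  have yh_eq: "(\<integral>x. y x * h x \<partial>M) = (\<integral>x. y x * max 0 (h x) \<partial>M) - (\<integral>x. y x * max 0 (- h x) \<partial>M)"
    unfolding split using yp_int ym_int by simp
  have ym_nonneg: "0 \<le> (\<integral>x. y x * max 0 (- h x) \<partial>M)"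
    by (rule Bochner_Integration.integral_nonneg) (simp add: y_nonneg)
  show thesis
  proof
    show "(\<integral>\<^sup>+x. ennreal (y x - marginal_cap k (Suc m)) \<partial>M) \<le> ennreal (1 / real (Suc m))" for m
    proof -
      have "y x - marginal_cap k (Suc m) \<le> y x * max 0 (- h x) / real (Suc m)" for x
      proof (cases "- real (Suc m) \<le> h x")
        case True
        then show ?thesis using y_cap[OF True] y_nonneg[of x]
          by (smt (verit) divide_nonneg_nonneg mult_nonneg_nonneg of_nat_0_le_iff max.cobounded1)
      next
        case False
        then have "y x * real (Suc m) \<le> y x * max 0 (- h x)" using y_nonneg[of x] by (intro mult_left_mono) auto
        then have "y x \<le> y x * max 0 (- h x) / real (Suc m)" by (simp add: pos_le_divide_eq)
        then show ?thesis using marginal_cap_nonneg[of k "Suc m", OF k] by linarith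
      qed
      then have "(\<integral>\<^sup>+x. ennreal (y x - marginal_cap k (Suc m)) \<partial>M)
          \<le> (\<integral>\<^sup>+x. ennreal (y x * max 0 (- h x) / real (Suc m)) \<partial>M)"
        by (intro nn_integral_mono ennreal_leI)
      also have "\<dots> = ennreal (\<integral>x. y x * max 0 (- h x) / real (Suc m) \<partial>M)"
        using ym_int y_nonneg by (intro nn_integral_eq_integral integrable_divide) auto
      also have "\<dots> \<le> ennreal (1 / real (Suc m))"
        using yh_nonneg yh_eq yp_le by (intro ennreal_leI) (simp add: divide_right_mono)
      finally show ?thesis .
    qed
    show "(\<integral>\<^sup>+x. ennreal (y x) * ennreal (f x) \<partial>M)
       \<le> (\<integral>\<^sup>+x. ennreal (y x) \<partial>M) + ennreal (1 / real (Suc n))" if f: "f \<in> D" for f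
    proof -
      have eq: "y x * f x = (y x * (r * (f x - f0 x)) + r * y x + y x * h x) / r" for x
        using r by (simp add: h_def field_simps)
      have int: "integrable M (\<lambda>x. y x * (r * (f x - f0 x)) + r * y x + y x * h x)"
        using foc(1)[OF f] y_int yh_int by simp
      then have yf_int: "integrable M (\<lambda>x. y x * f x)" unfolding eq by simp
      have "(\<integral>x. y x * f x \<partial>M)
          = ((\<integral>x. y x * (r * (f x - f0 x)) \<partial>M) + r * (\<integral>x. y x \<partial>M) + (\<integral>x. y x * h x \<partial>M)) / r"
        unfolding eq using foc(1)[OF f] y_int yh_int by simp
      also have "\<dots> \<le> (0 + r * (\<integral>x. y x \<partial>M) + 1) / r"
        using foc(2)[OF f] yh_eq yp_le ym_nonneg r by (intro divide_right_mono add_mono) auto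
      also have "\<dots> = (\<integral>x. y x \<partial>M) + 1 / real (Suc n)" using r by (simp add: add_divide_distrib r_def)
      finally have le: "(\<integral>x. y x * f x \<partial>M) \<le> (\<integral>x. y x \<partial>M) + 1 / real (Suc n)" .
      have "(\<integral>\<^sup>+x. ennreal (y x) * ennreal (f x) \<partial>M) = (\<integral>\<^sup>+x. ennreal (y x * f x) \<partial>M)"
        using y_nonneg by (simp add: ennreal_mult')
      also have "\<dots> = ennreal (\<integral>x. y x * f x \<partial>M)"
        using yf_int y_nonneg D_nonneg[OF f] by (intro nn_integral_eq_integral) auto
      also have "\<dots> \<le> ennreal ((\<integral>x. y x \<partial>M) + 1 / real (Suc n))" by (rule ennreal_leI[OF le])
      also have "\<dots> = ennreal (\<integral>x. y x \<partial>M) + ennreal (1 / real (Suc n))"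
        using Bochner_Integration.integral_nonneg[of M y, OF y_nonneg] by (intro ennreal_plus) auto
      also have "ennreal (\<integral>x. y x \<partial>M) = (\<integral>\<^sup>+x. ennreal (y x) \<partial>M)"
        using y_int y_nonneg by (intro nn_integral_eq_integral[symmetric]) auto
      finally show ?thesis .
    qed
    show "ennreal ((prob A * (1 - exp (- l)) - \<beta>) / l) \<le> (\<integral>\<^sup>+x. ennreal (y x) * indicator A x \<partial>M)"
    proof -
      have yA_int: "integrable M (\<lambda>x. y x * indicator A x)"
        by (rule integrable_const_bound[where B="marginal_cap k (Suc n)"])
          (use y_le y_nonneg marginal_cap_nonneg[OF k] in \<open>auto simp: indicator_def\<close>)
      have U_int: "integrable M (\<lambda>x. util (indicator A x) k n (h x))"
        unfolding h_def using r by (intro util_integrable A k f0) auto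
      have "prob A * (1 - exp (- l)) = (\<integral>x. indicator A x * (1 - exp (- l)) \<partial>M)"
        by (simp add: emeasure_eq_measure)
      also have "\<dots> \<le> (\<integral>x. util (indicator A x) k n (h x) + (l * (y x * indicator A x) - y x * h x) \<partial>M)"
      proof (rule integral_mono)
        show "integrable M (\<lambda>x. indicator A x * (1 - exp (- l)))" by (simp add: emeasure_eq_measure)
        show "integrable M (\<lambda>x. util (indicator A x) k n (h x) + (l * (y x * indicator A x) - y x * h x))"
          using yA_int U_int yh_int by simp
        fix x
        have "util (indicator A x) k n (l * indicator A x)
            \<le> util (indicator A x) k n (h x) + y x * (l * indicator A x - h x)"
          unfolding y_def by (intro util_tangent k) simp
        moreover have "util (indicator A x) k n (l * indicator A x) = indicator A x * (1 - exp (- l))"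
          using l by (subst util_nonneg_arg) (auto simp: indicator_def)
        ultimately show "indicator A x * (1 - exp (- l))
            \<le> util (indicator A x) k n (h x) + (l * (y x * indicator A x) - y x * h x)"
          by (simp add: algebra_simps)
      qed
      also have "\<dots> = expected_util A k n r f0 + (l * (\<integral>x. y x * indicator A x \<partial>M) - (\<integral>x. y x * h x \<partial>M))"
        using yA_int U_int yh_int by (simp add: expected_util_def h_def[symmetric])
      also have "\<dots> \<le> \<beta> + l * (\<integral>x. y x * indicator A x \<partial>M)"
        using \<beta>[OF f0] yh_nonneg by (simp add: r_def)
      finally have "(prob A * (1 - exp (- l)) - \<beta>) / l \<le> (\<integral>x. y x * indicator A x \<partial>M)"
        using l by (simp add: field_simps)
      then have "ennreal ((prob A * (1 - exp (- l)) - \<beta>) / l) \<le> ennreal (\<integral>x. y x * indicator A x \<partial>M)"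
        by (rule ennreal_leI)
      also have "\<dots> = (\<integral>\<^sup>+x. ennreal (y x * indicator A x) \<partial>M)"
        using yA_int y_nonneg by (intro nn_integral_eq_integral[symmetric]) auto
      also have "\<dots> = (\<integral>\<^sup>+x. ennreal (y x) * indicator A x \<partial>M)"
        by (intro nn_integral_cong) (auto simp: indicator_def)
      finally show ?thesis .
    qed
  qed (fact y_meas y_nonneg)+
qed

text \<open>The approximate densities for increasing \<open>n\<close> belong to a decreasing sequence of convex sets.  The
selection lemma provides a convergent sequence, no mass is lost in the limit because of the excess
bounds, and the error \<open>1 / (n + 1)\<close> disappears.\<close>

lemma separating_density_charging:
  assumes A[measurable]: "A \<in> sets M" and pos: "0 < prob A"
  obtains y where "y \<in> borel_measurable M" "\<And>x. 0 \<le> y x" "(\<integral>\<^sup>+x. ennreal (y x) \<partial>M) < \<infinity>"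
    "\<And>f. f \<in> D \<Longrightarrow> (\<integral>\<^sup>+x. ennreal (y x) * ennreal (f x) \<partial>M) \<le> (\<integral>\<^sup>+x. ennreal (y x) \<partial>M)"
    "0 < (\<integral>\<^sup>+x. ennreal (y x) * indicator A x \<partial>M)"
proof -
  obtain k \<beta> where k: "\<And>j. 0 \<le> k j" and \<beta>: "\<beta> < prob A"
    "\<And>n f. f \<in> D \<Longrightarrow> expected_util A k n (Suc n) f \<le> \<beta>"
    using bounded_utility_family[OF A pos] by blast
  \<comment> \<open>makes the lower bound \<open>c\<close> on the mass of \<open>A\<close> positive\<close>
  obtain l where l: "0 < l" "prob A * exp (- l) < prob A - \<beta>"
  proof -
    have "((\<lambda>l. prob A * exp (- l)) \<longlongrightarrow> prob A * 0) at_top"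
      by (intro tendsto_intros filterlim_compose[OF exp_at_bot filterlim_uminus_at_bot_at_top])
    then have "eventually (\<lambda>l. prob A * exp (- l) < prob A - \<beta>) at_top"
      using \<beta>(1) by (intro order_tendstoD(2)) auto
    then have "eventually (\<lambda>l. 0 < l \<and> prob A * exp (- l) < prob A - \<beta>) at_top"
      using eventually_gt_at_top[of 0] by eventually_elim auto
    then show ?thesis using that eventually_happens' trivial_limit_at_top_linorder by blast
  qed
  define c where "c = (prob A * (1 - exp (- l)) - \<beta>) / l"
  have c: "0 < c" using l by (simp add: c_def algebra_simps)
  define G where "G m = marginal_cap k (Suc m)" for m
  have G: "0 \<le> G m" for m unfolding G_def by (rule marginal_cap_nonneg[OF k])
  define Y where "Y n = {y \<in> borel_measurable M. (\<forall>x. 0 \<le> y x)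
    \<and> ennreal c \<le> (\<integral>\<^sup>+x. ennreal (y x) * indicator A x \<partial>M)
    \<and> (\<forall>m. (\<integral>\<^sup>+x. ennreal (y x - G m) \<partial>M) \<le> ennreal (1 / real (Suc m)))
    \<and> (\<forall>f\<in>D. (\<integral>\<^sup>+x. ennreal (y x) * ennreal (f x) \<partial>M)
       \<le> (\<integral>\<^sup>+x. ennreal (y x) \<partial>M) + ennreal (1 / real (Suc n)))}" for n
  have Y_mass: "(\<integral>\<^sup>+x. ennreal (y x) \<partial>M) \<le> ennreal (G 0 + 1)" if "y \<in> Y n" for y n
  proof -
    have [measurable]: "y \<in> borel_measurable M" using that by (simp add: Y_def)
    have "(\<integral>\<^sup>+x. ennreal (y x) \<partial>M) = (\<integral>\<^sup>+x. ennreal (y x) * indicator (space M) x \<partial>M)"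
      by (intro nn_integral_cong) auto
    also have "\<dots> \<le> (\<integral>\<^sup>+x. ennreal (min (y x) (G 0)) * indicator (space M) x \<partial>M) + (\<integral>\<^sup>+x. ennreal (y x - G 0) \<partial>M)"
      by (rule nn_integral_le_cap_plus_excess[OF _ _ G]) auto
    also have "\<dots> \<le> (\<integral>\<^sup>+x. ennreal (G 0) \<partial>M) + ennreal (1 / real (Suc 0))"
    proof (rule add_mono)
      show "(\<integral>\<^sup>+x. ennreal (min (y x) (G 0)) * indicator (space M) x \<partial>M) \<le> (\<integral>\<^sup>+x. ennreal (G 0) \<partial>M)"
        by (intro nn_integral_mono) (auto intro!: ennreal_leI)
      show "(\<integral>\<^sup>+x. ennreal (y x - G 0) \<partial>M) \<le> ennreal (1 / real (Suc 0))"
        using that unfolding Y_def by blast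
    qed
    also have "\<dots> = ennreal (G 0 + 1)" using G[of 0] by (simp add: emeasure_space_1)
    finally show ?thesis .
  qed
  have "\<exists>u y. (\<forall>n. u n \<in> Y n) \<and> y \<in> borel_measurable M \<and> (\<forall>x. 0 \<le> y x) \<and>
    (AE x in M. (\<lambda>n. u n x) \<longlonglongrightarrow> y x)"
  proof (rule convergent_selection)
    show "Y (Suc n) \<subseteq> Y n" for n
    proof
      fix y assume y: "y \<in> Y (Suc n)"
      have "ennreal (1 / real (Suc (Suc n))) \<le> ennreal (1 / real (Suc n))"
        by (intro ennreal_leI frac_le) auto
      then have le: "X + ennreal (1 / real (Suc (Suc n))) \<le> X + ennreal (1 / real (Suc n))" for X
        by (rule add_left_mono)
      show "y \<in> Y n" using y unfolding Y_def by (blast intro: order_trans[OF _ le])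
    qed
    show "Y n \<noteq> {}" for n
    proof (rule approximate_density[of A k n \<beta> l, OF A k \<beta>(2) l(1)])
      fix y :: "'a \<Rightarrow> real"
      assume "y \<in> borel_measurable M" "\<And>x. 0 \<le> y x"
        "ennreal ((prob A * (1 - exp (- l)) - \<beta>) / l) \<le> (\<integral>\<^sup>+x. ennreal (y x) * indicator A x \<partial>M)"
        "\<And>m. (\<integral>\<^sup>+x. ennreal (y x - marginal_cap k (Suc m)) \<partial>M) \<le> ennreal (1 / real (Suc m))"
        "\<And>f. f \<in> D \<Longrightarrow> (\<integral>\<^sup>+x. ennreal (y x) * ennreal (f x) \<partial>M)
           \<le> (\<integral>\<^sup>+x. ennreal (y x) \<partial>M) + ennreal (1 / real (Suc n))"
      then have "y \<in> Y n" unfolding Y_def c_def G_def by (intro CollectI conjI allI ballI)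
      then show ?thesis by blast
    qed
    show "y \<in> borel_measurable M" if "y \<in> Y n" for y n using that by (simp add: Y_def)
    show "0 \<le> y x" if "y \<in> Y n" for y n x using that by (simp add: Y_def)
    show "(\<lambda>x. (y x + z x) / 2) \<in> Y n" if y: "y \<in> Y n" and z: "z \<in> Y n" for y z n
    proof -
      have m[measurable]: "y \<in> borel_measurable M" "z \<in> borel_measurable M" using y z by (auto simp: Y_def)
      have nn: "\<And>x. 0 \<le> y x" "\<And>x. 0 \<le> z x" using y z by (auto simp: Y_def)
      note mid = nn_integral_midpoint[OF m _ nn]
      have 1: "ennreal c \<le> (\<integral>\<^sup>+x. ennreal ((y x + z x) / 2) * indicator A x \<partial>M)"
      proof -
        have "ennreal c = ennreal (1/2) * (ennreal c + ennreal c)" by (rule ennreal_half_add_self[symmetric])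
        also have "\<dots> \<le> (\<integral>\<^sup>+x. ennreal ((y x + z x) / 2) * indicator A x \<partial>M)"
          using y z by (subst mid) (auto simp: Y_def intro!: mult_left_mono add_mono)
        finally show ?thesis .
      qed
      have 2: "(\<integral>\<^sup>+x. ennreal ((y x + z x) / 2 - G m) \<partial>M) \<le> ennreal (1 / real (Suc m))" for m
      proof -
        have pos: "(\<integral>\<^sup>+x. ennreal (max 0 (w x - G m)) * 1 \<partial>M) \<le> ennreal (1 / real (Suc m))" if "w \<in> Y n" for w
        proof -
          have "ennreal (max 0 (w x - G m)) * 1 = ennreal (w x - G m)" for x
            by (cases "0 \<le> w x - G m") (auto simp: max_def ennreal_neg)
          then show ?thesis using that unfolding Y_def by (simp only:) blast
        qed
        have "(\<integral>\<^sup>+x. ennreal ((y x + z x) / 2 - G m) \<partial>M)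
            \<le> (\<integral>\<^sup>+x. ennreal ((max 0 (y x - G m) + max 0 (z x - G m)) / 2) * 1 \<partial>M)"
        proof (rule nn_integral_mono)
          fix x
          have "(y x + z x) / 2 - G m \<le> (max 0 (y x - G m) + max 0 (z x - G m)) / 2"
            by (auto simp: max_def field_simps)
          then show "ennreal ((y x + z x) / 2 - G m) \<le> ennreal ((max 0 (y x - G m) + max 0 (z x - G m)) / 2) * 1"
            by (simp add: ennreal_leI)
        qed
        also have "\<dots> = ennreal (1/2) * ((\<integral>\<^sup>+x. ennreal (max 0 (y x - G m)) * 1 \<partial>M) + (\<integral>\<^sup>+x. ennreal (max 0 (z x - G m)) * 1 \<partial>M))"
          using m by (intro nn_integral_midpoint[where f="\<lambda>x. max 0 (y x - G m)" and h="\<lambda>x. max 0 (z x - G m)" and w="\<lambda>_. 1"])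
            simp_all
        also have "\<dots> \<le> ennreal (1/2) * (ennreal (1 / real (Suc m)) + ennreal (1 / real (Suc m)))"
          by (rule mult_left_mono[OF add_mono[OF pos[OF y] pos[OF z]]]) (rule zero_le)
        also have "\<dots> = ennreal (1 / real (Suc m))" by (rule ennreal_half_add_self)
        finally show ?thesis .
      qed
      have 3: "(\<integral>\<^sup>+x. ennreal ((y x + z x) / 2) * ennreal (f x) \<partial>M)
          \<le> (\<integral>\<^sup>+x. ennreal ((y x + z x) / 2) \<partial>M) + ennreal (1 / real (Suc n))" if f: "f \<in> D" for f
      proof -
        let ?e = "ennreal (1 / real (Suc n))"
        have bound: "(\<integral>\<^sup>+x. ennreal (w x) * ennreal (f x) \<partial>M) \<le> (\<integral>\<^sup>+x. ennreal (w x) \<partial>M) + ?e" if "w \<in> Y n" for w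
          using that f unfolding Y_def by blast
        have [measurable]: "f \<in> borel_measurable M" by (rule D_measurable[OF f])
        have "(\<integral>\<^sup>+x. ennreal ((y x + z x) / 2) * ennreal (f x) \<partial>M)
          = ennreal (1/2) * ((\<integral>\<^sup>+x. ennreal (y x) * ennreal (f x) \<partial>M) + (\<integral>\<^sup>+x. ennreal (z x) * ennreal (f x) \<partial>M))"
          by (rule mid) measurable
        also have "\<dots> \<le> ennreal (1/2) * (((\<integral>\<^sup>+x. ennreal (y x) \<partial>M) + ?e) + ((\<integral>\<^sup>+x. ennreal (z x) \<partial>M) + ?e))"
          by (rule mult_left_mono[OF add_mono[OF bound[OF y] bound[OF z]]]) (rule zero_le)
        also have "\<dots> = ennreal (1/2) * ((\<integral>\<^sup>+x. ennreal (y x) \<partial>M) + (\<integral>\<^sup>+x. ennreal (z x) \<partial>M)) + ennreal (1/2) * (?e + ?e)"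
          by (simp only: distrib_left ac_simps)
        also have "\<dots> = (\<integral>\<^sup>+x. ennreal ((y x + z x) / 2) \<partial>M) + ?e"
        proof -
          have "(\<integral>\<^sup>+x. ennreal ((y x + z x) / 2) * 1 \<partial>M)
            = ennreal (1/2) * ((\<integral>\<^sup>+x. ennreal (y x) * 1 \<partial>M) + (\<integral>\<^sup>+x. ennreal (z x) * 1 \<partial>M))"
            by (rule mid) measurable
          then show ?thesis by (simp only: ennreal_half_add_self mult_1_right)
        qed
        finally show ?thesis .
      qed
      have "0 \<le> (y x + z x) / 2" for x using nn[of x] by simp
      moreover have "(\<lambda>x. (y x + z x) / 2) \<in> borel_measurable M" by measurable
      ultimately show ?thesis using 1 2 3 unfolding Y_def by (intro CollectI conjI allI ballI)
    qed
    show "\<exists>L. \<forall>y\<in>Y 0. prob {x \<in> space M. L < y x} \<le> \<epsilon>" if "0 < \<epsilon>" for \<epsilon>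
    proof (intro exI ballI)
      fix y assume y: "y \<in> Y 0"
      define L where "L = (G 0 + 1) / \<epsilon>"
      have L: "0 < L" using that G[of 0] by (simp add: L_def)
      have [measurable]: "y \<in> borel_measurable M" using y by (simp add: Y_def)
      have scale: "1 \<le> ennreal (1 / L) * ennreal (y x)" if "L < y x" for x
      proof -
        have "1 \<le> 1 / L * y x" using that L by (simp add: field_simps)
        then have "ennreal 1 \<le> ennreal (1 / L * y x)" by (rule ennreal_leI)
        also have "\<dots> = ennreal (1 / L) * ennreal (y x)" using that L by (intro ennreal_mult) auto
        finally show ?thesis by simp
      qed
      have "ennreal (prob {x \<in> space M. L < y x}) \<le> emeasure M {x \<in> space M. 1 \<le> ennreal (1 / L) * ennreal (y x)}"
        unfolding emeasure_eq_measure[symmetric] by (rule emeasure_mono) (use scale in blast, measurable)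
      also have "\<dots> \<le> ennreal (1 / L) * (\<integral>\<^sup>+x. ennreal (y x) * indicator (space M) x \<partial>M)"
        by (rule nn_integral_Markov_inequality) measurable
      also have "(\<integral>\<^sup>+x. ennreal (y x) * indicator (space M) x \<partial>M) = (\<integral>\<^sup>+x. ennreal (y x) \<partial>M)"
        by (intro nn_integral_cong) auto
      also have "ennreal (1 / L) * \<dots> \<le> ennreal (1 / L) * ennreal (G 0 + 1)"
        by (intro mult_left_mono Y_mass[OF y]) auto
      also have "\<dots> = ennreal (1 / L * (G 0 + 1))" using L G[of 0] by (intro ennreal_mult[symmetric]) auto
      also have "1 / L * (G 0 + 1) = \<epsilon>" using G[of 0] that by (simp add: L_def)
      finally show "prob {x \<in> space M. (G 0 + 1) / \<epsilon> < y x} \<le> \<epsilon>" using that by (simp add: L_def)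
    qed
  qed
  then obtain u y where u: "\<And>n. u n \<in> Y n" and y[measurable]: "y \<in> borel_measurable M" and y_nonneg: "\<And>x. 0 \<le> y x"
    and lim: "AE x in M. (\<lambda>n. u n x) \<longlonglongrightarrow> y x" by blast
  have [measurable]: "u i \<in> borel_measurable M" for i using u[of i] by (simp add: Y_def)
  have conv: "(\<lambda>i. \<integral>\<^sup>+x. ennreal (u i x) * indicator B x \<partial>M) \<longlonglongrightarrow> (\<integral>\<^sup>+x. ennreal (y x) * indicator B x \<partial>M)"
    if "B \<in> sets M" for B
    using u that by (intro nn_integral_tendsto_of_excess_bound[where G=G] lim G) (auto simp: Y_def)
  have "(\<integral>\<^sup>+x. ennreal (w x) * indicator (space M) x \<partial>M) = (\<integral>\<^sup>+x. ennreal (w x) \<partial>M)" for w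
    by (intro nn_integral_cong) auto
  then have mass: "(\<lambda>i. \<integral>\<^sup>+x. ennreal (u i x) \<partial>M) \<longlonglongrightarrow> (\<integral>\<^sup>+x. ennreal (y x) \<partial>M)"
    using conv[of "space M"] by simp
  show thesis
  proof
    have "(\<integral>\<^sup>+x. ennreal (y x) \<partial>M) \<le> ennreal (G 0 + 1)"
      by (rule LIMSEQ_le_const2[OF mass]) (use Y_mass[OF u] in auto)
    then show "(\<integral>\<^sup>+x. ennreal (y x) \<partial>M) < \<infinity>" by (simp add: le_less_trans)
    have "ennreal c \<le> (\<integral>\<^sup>+x. ennreal (y x) * indicator A x \<partial>M)"
      by (rule LIMSEQ_le_const[OF conv[OF A]]) (use u in \<open>auto simp: Y_def\<close>)
    moreover have "0 < ennreal c" using c by simp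
    ultimately show "0 < (\<integral>\<^sup>+x. ennreal (y x) * indicator A x \<partial>M)" by (rule less_le_trans[rotated])
    fix f assume f: "f \<in> D"
    have [measurable]: "f \<in> borel_measurable M" by (rule D_measurable[OF f])
    have "(\<integral>\<^sup>+x. ennreal (y x) * ennreal (f x) \<partial>M) = (\<integral>\<^sup>+x. liminf (\<lambda>i. ennreal (u i x) * ennreal (f x)) \<partial>M)"
    proof (rule nn_integral_cong_AE)
      show "AE x in M. ennreal (y x) * ennreal (f x) = liminf (\<lambda>i. ennreal (u i x) * ennreal (f x))"
        using lim
      proof eventually_elim
        case (elim x)
        have "0 \<le> u i x" for i using u[of i] by (simp add: Y_def)
        then have "ennreal (u i x) * ennreal (f x) = ennreal (u i x * f x)" for i
          by (simp add: ennreal_mult D_nonneg[OF f])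
        moreover have "ennreal (y x) * ennreal (f x) = ennreal (y x * f x)"
          by (simp add: ennreal_mult D_nonneg[OF f] y_nonneg)
        moreover have "(\<lambda>i. ennreal (u i x * f x)) \<longlonglongrightarrow> ennreal (y x * f x)"
          by (rule tendsto_ennrealI[OF tendsto_mult_right[OF elim]])
        ultimately show ?case by (simp only:) (rule lim_imp_Liminf[symmetric], simp_all)
      qed
    qed
    also have "\<dots> \<le> liminf (\<lambda>i. \<integral>\<^sup>+x. ennreal (u i x) * ennreal (f x) \<partial>M)"
      by (rule nn_integral_liminf) measurable
    also have "\<dots> \<le> liminf (\<lambda>i. (\<integral>\<^sup>+x. ennreal (u i x) \<partial>M) + ennreal (1 / real (Suc i)))"
    proof (intro Liminf_mono always_eventually allI)
      show "(\<integral>\<^sup>+x. ennreal (u i x) * ennreal (f x) \<partial>M) \<le> (\<integral>\<^sup>+x. ennreal (u i x) \<partial>M) + ennreal (1 / real (Suc i))" for i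
        using u[of i] f unfolding Y_def by blast
    qed
    also have "\<dots> = (\<integral>\<^sup>+x. ennreal (y x) \<partial>M) + ennreal 0"
      by (intro lim_imp_Liminf tendsto_add mass tendsto_ennrealI LIMSEQ_Suc lim_1_over_n) simp
    finally show "(\<integral>\<^sup>+x. ennreal (y x) * ennreal (f x) \<partial>M) \<le> (\<integral>\<^sup>+x. ennreal (y x) \<partial>M)" by simp
  qed (fact y y_nonneg)+
qed

text \<open>Exhaustion: countable convex combinations provide a separating density that is positive on an event
of maximal probability, and a density charging the complement of that event would enlarge it.\<close>

lemma separating_density:
  obtains y where "y \<in> borel_measurable M" "AE x in M. 0 < y x" "(\<integral>\<^sup>+x. y x \<partial>M) < \<infinity>"
    "\<And>f. f \<in> D \<Longrightarrow> (\<integral>\<^sup>+x. y x * ennreal (f x) \<partial>M) \<le> (\<integral>\<^sup>+x. y x \<partial>M)"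
proof -
  define Z where "Z = {y \<in> borel_measurable M. (\<integral>\<^sup>+x. y x \<partial>M) \<le> 1
    \<and> (\<forall>f\<in>D. (\<integral>\<^sup>+x. y x * ennreal (f x) \<partial>M) \<le> (\<integral>\<^sup>+x. y x \<partial>M))}"
  define p where "p y = prob {x \<in> space M. 0 < y x}" for y :: "'a \<Rightarrow> ennreal"
  define s where "s = (SUP y\<in>Z. p y)"
  have bdd: "bdd_above (p ` Z)" by (auto simp: p_def intro!: bdd_aboveI[of _ 1])
  have "(\<lambda>_. 0) \<in> Z" by (simp add: Z_def)
  then have ne: "Z \<noteq> {}" by blast
  have "\<exists>y\<in>Z. s - 1 / real (Suc n) < p y" for n
  proof -
    have "s - 1 / real (Suc n) < (SUP y\<in>Z. p y)" by (simp add: s_def)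
    then show ?thesis using less_cSUP_iff[OF ne bdd] by blast
  qed
  then obtain u where u: "\<And>n. u n \<in> Z" "\<And>n. s - 1 / real (Suc n) < p (u n)" by metis
  define a where "a n = ennreal ((1/2) ^ Suc n)" for n
  have a_pos: "0 < a n" for n by (simp add: a_def)
  have a_sum: "(\<Sum>n. a n) = 1"
  proof -
    have "(\<lambda>n. (1/2::real) ^ Suc n) sums 1" by (rule power_half_series)
    then show ?thesis unfolding a_def by (subst suminf_ennreal_eq) auto
  qed
  define y where "y x = (\<Sum>n. a n * u n x)" for x
  have [measurable]: "u n \<in> borel_measurable M" for n using u(1)[of n] by (simp add: Z_def)
  have y_meas[measurable]: "y \<in> borel_measurable M" unfolding y_def by measurable
  have int_y: "(\<integral>\<^sup>+x. y x * w x \<partial>M) = (\<Sum>n. a n * (\<integral>\<^sup>+x. u n x * w x \<partial>M))"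
    if [measurable]: "w \<in> borel_measurable M" for w :: "'a \<Rightarrow> ennreal"
  proof -
    have "(\<integral>\<^sup>+x. y x * w x \<partial>M) = (\<integral>\<^sup>+x. (\<Sum>n. a n * (u n x * w x)) \<partial>M)"
      unfolding y_def by (simp add: ennreal_suminf_multc[symmetric] mult.assoc)
    also have "\<dots> = (\<Sum>n. \<integral>\<^sup>+x. a n * (u n x * w x) \<partial>M)" by (rule nn_integral_suminf) measurable
    finally show ?thesis by (simp add: nn_integral_cmult)
  qed
  have y1: "(\<integral>\<^sup>+x. y x \<partial>M) = (\<Sum>n. a n * (\<integral>\<^sup>+x. u n x \<partial>M))" using int_y[of "\<lambda>_. 1"] by simp
  have y_le: "(\<integral>\<^sup>+x. y x * ennreal (f x) \<partial>M) \<le> (\<integral>\<^sup>+x. y x \<partial>M)" if f: "f \<in> D" for f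
  proof -
    have [measurable]: "f \<in> borel_measurable M" by (rule D_measurable[OF f])
    have "(\<integral>\<^sup>+x. y x * ennreal (f x) \<partial>M) = (\<Sum>n. a n * (\<integral>\<^sup>+x. u n x * ennreal (f x) \<partial>M))"
      by (rule int_y) measurable
    also have "\<dots> \<le> (\<Sum>n. a n * (\<integral>\<^sup>+x. u n x \<partial>M))"
    proof (intro suminf_le summableI mult_left_mono)
      show "(\<integral>\<^sup>+x. u n x * ennreal (f x) \<partial>M) \<le> (\<integral>\<^sup>+x. u n x \<partial>M)" for n
        using u(1)[of n] f unfolding Z_def by blast
    qed simp
    finally show ?thesis by (simp only: y1)
  qed
  have y_mass: "(\<integral>\<^sup>+x. y x \<partial>M) \<le> 1"
  proof -
    have "(\<Sum>n. a n * (\<integral>\<^sup>+x. u n x \<partial>M)) \<le> (\<Sum>n. a n)"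
    proof (intro suminf_le summableI)
      show "a n * (\<integral>\<^sup>+x. u n x \<partial>M) \<le> a n" for n
        using mult_left_mono[of "\<integral>\<^sup>+x. u n x \<partial>M" 1 "a n"] u(1)[of n] by (simp add: Z_def)
    qed
    then show ?thesis by (simp only: y1 a_sum)
  qed
  have s_le: "s \<le> p y"
  proof (rule field_le_epsilon)
    fix e :: real assume "0 < e"
    then obtain n where n: "1 / real (Suc n) < e" using nat_approx_posE by metis
    have "u n x \<noteq> 0 \<Longrightarrow> 0 < y x" for x
    proof -
      assume "u n x \<noteq> 0"
      then have "0 < a n * u n x" using a_pos[of n] by (simp add: ennreal_zero_less_mult_iff zero_less_iff_neq_zero)
      also have "\<dots> = (\<Sum>i\<in>{n}. a i * u i x)" by simp
      also have "\<dots> \<le> y x" unfolding y_def by (rule sum_le_suminf) auto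
      finally show ?thesis .
    qed
    then have "p (u n) \<le> p y" unfolding p_def by (intro finite_measure_mono) (auto simp: zero_less_iff_neq_zero)
    then show "s \<le> p y + e" using u(2)[of n] n by linarith
  qed
  let ?A = "{x \<in> space M. y x = 0}"
  have "prob ?A = 0"
  proof (rule ccontr)
    assume "prob ?A \<noteq> 0"
    then have pos: "0 < prob ?A" by (simp add: zero_less_measure_iff)
    have A: "?A \<in> sets M" by measurable
    show False
    proof (rule separating_density_charging[OF A pos])
      fix z assume z[measurable]: "z \<in> borel_measurable M" and "\<And>x. 0 \<le> z x"
        and z_fin: "(\<integral>\<^sup>+x. ennreal (z x) \<partial>M) < \<infinity>"
        and z_le: "\<And>f. f \<in> D \<Longrightarrow> (\<integral>\<^sup>+x. ennreal (z x) * ennreal (f x) \<partial>M) \<le> (\<integral>\<^sup>+x. ennreal (z x) \<partial>M)"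
        and z_A: "0 < (\<integral>\<^sup>+x. ennreal (z x) * indicator ?A x \<partial>M)"
      obtain T where T: "0 \<le> T" "(\<integral>\<^sup>+x. ennreal (z x) \<partial>M) = ennreal T"
        using z_fin by (cases "\<integral>\<^sup>+x. ennreal (z x) \<partial>M") auto
      define b where "b = ennreal (1 / (1 + T))"
      have b: "0 < b" using T by (simp add: b_def)
      define w where "w x = b * (y x + ennreal (z x))" for x
      have [measurable]: "w \<in> borel_measurable M" unfolding w_def by measurable
      have int_w: "(\<integral>\<^sup>+x. w x * v x \<partial>M) = b * ((\<integral>\<^sup>+x. y x * v x \<partial>M) + (\<integral>\<^sup>+x. ennreal (z x) * v x \<partial>M))"
        if [measurable]: "v \<in> borel_measurable M" for v :: "'a \<Rightarrow> ennreal"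
      proof -
        have "(\<integral>\<^sup>+x. w x * v x \<partial>M) = (\<integral>\<^sup>+x. b * (y x * v x + ennreal (z x) * v x) \<partial>M)"
          unfolding w_def by (simp add: algebra_simps)
        then show ?thesis by (simp add: nn_integral_cmult nn_integral_add)
      qed
      have w1: "(\<integral>\<^sup>+x. w x \<partial>M) = b * ((\<integral>\<^sup>+x. y x \<partial>M) + (\<integral>\<^sup>+x. ennreal (z x) \<partial>M))"
        using int_w[of "\<lambda>_. 1"] by simp
      have "w \<in> Z" unfolding Z_def
      proof (intro CollectI conjI ballI)
        have "(\<integral>\<^sup>+x. w x \<partial>M) \<le> b * (ennreal 1 + ennreal T)"
          unfolding w1 T(2) using y_mass by (intro mult_left_mono add_mono) auto
        also have "\<dots> = b * ennreal (1 + T)" using T(1) by (simp only: ennreal_plus[of 1 T, symmetric] zero_le_one)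
        also have "\<dots> = ennreal (1 / (1 + T) * (1 + T))" unfolding b_def using T(1) by (intro ennreal_mult[symmetric]) auto
        finally show "(\<integral>\<^sup>+x. w x \<partial>M) \<le> 1" using T(1) by simp
        fix f assume f: "f \<in> D"
        have [measurable]: "f \<in> borel_measurable M" by (rule D_measurable[OF f])
        have "(\<integral>\<^sup>+x. w x * ennreal (f x) \<partial>M)
          = b * ((\<integral>\<^sup>+x. y x * ennreal (f x) \<partial>M) + (\<integral>\<^sup>+x. ennreal (z x) * ennreal (f x) \<partial>M))"
          by (rule int_w) measurable
        also have "\<dots> \<le> b * ((\<integral>\<^sup>+x. y x \<partial>M) + (\<integral>\<^sup>+x. ennreal (z x) \<partial>M))"
          by (intro mult_left_mono add_mono y_le z_le f) simp
        finally show "(\<integral>\<^sup>+x. w x * ennreal (f x) \<partial>M) \<le> (\<integral>\<^sup>+x. w x \<partial>M)" by (simp only: w1)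
      qed measurable
      then have "p w \<le> s" unfolding s_def by (rule cSUP_upper[OF _ bdd])
      moreover have "p w = p y + prob {x \<in> ?A. 0 < z x}"
      proof -
        have "0 < w x \<longleftrightarrow> 0 < y x \<or> 0 < z x" for x
          using b unfolding w_def
          by (auto simp: ennreal_zero_less_mult_iff add_pos_nonneg zero_less_iff_neq_zero ennreal_eq_0_iff)
        then have "{x \<in> space M. 0 < w x} = {x \<in> space M. 0 < y x} \<union> {x \<in> ?A. 0 < z x}"
          by (auto simp: zero_less_iff_neq_zero)
        then show ?thesis unfolding p_def
          by (simp only:) (rule finite_measure_Union, auto)
      qed
      moreover have "0 < prob {x \<in> ?A. 0 < z x}"
      proof (rule ccontr)
        assume "\<not> 0 < prob {x \<in> ?A. 0 < z x}"
        then have "{x \<in> ?A. 0 < z x} \<in> null_sets M"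
          by (simp add: zero_less_measure_iff null_sets_def emeasure_eq_measure)
        then have "AE x in M. x \<notin> {x \<in> ?A. 0 < z x}" by (rule AE_not_in)
        then have "AE x in M. ennreal (z x) * indicator ?A x = 0"
          using AE_space by eventually_elim (auto simp: indicator_def ennreal_neg)
        then have "(\<integral>\<^sup>+x. ennreal (z x) * indicator ?A x \<partial>M) = 0"
          by (subst nn_integral_0_iff_AE) auto
        then show False using z_A by simp
      qed
      ultimately show False using s_le by linarith
    qed
  qed
  then have "AE x in M. x \<notin> ?A" by (intro AE_not_in) (simp add: null_sets_def emeasure_eq_measure)
  then have "AE x in M. 0 < y x" using AE_space by eventually_elim (auto simp: zero_less_iff_neq_zero)
  moreover have "(\<integral>\<^sup>+x. y x \<partial>M) < \<infinity>" using y_mass by (rule le_less_trans) simp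
  ultimately show thesis using that y_meas y_le by blast
qed

end

section \<open>Equivalence classes and the closed set generated by extrapolation\<close>

lemma equiv_probs_AE_iff:
  assumes "Q \<in> equiv_probs M"
  shows "(AE x in Q. P x) \<longleftrightarrow> (AE x in M. P x)"
proof -
  have "sets Q = sets M" "null_sets Q = null_sets M" using assms by (auto simp: equiv_probs_def)
  then show ?thesis
    unfolding eventually_ae_filter using sets_eq_imp_space_eq[of Q M] by (simp only:)
qed

lemma equiv_probsD:
  assumes "Q \<in> equiv_probs M"
  shows "prob_space Q" "sets Q = sets M" "space Q = space M"
    "\<And>f::'a \<Rightarrow> real. f \<in> borel_measurable M \<Longrightarrow> f \<in> borel_measurable Q"
    "\<And>f::'a \<Rightarrow> real. f \<in> borel_measurable Q \<Longrightarrow> f \<in> borel_measurable M"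
  using assms sets_eq_imp_space_eq[of Q M] measurable_cong_sets[of Q M borel borel]
  by (auto simp: equiv_probs_def)

lemma L0_class_eqI:
  assumes "f \<in> borel_measurable M" "F \<in> L0 M" "AE x in M. f x = rep F x"
  shows "L0_class M f = F"
proof -
  have "AE x in M. rep (L0_class M f) x = rep F x"
    using AE_rep_L0_class[OF assms(1)] assms(3) by eventually_elim simp
  then show ?thesis using L0_eq_iff[OF L0_class_in_L0[OF assms(1)] assms(2)] by simp
qed

lemma AE_rep_lincomb:
  assumes [measurable]: "F \<in> L0 M" "H \<in> L0 M"
  shows "AE x in M. rep (lincomb M a F b H) x = a * rep F x + b * rep H x"
  unfolding lincomb_def by (rule AE_rep_L0_class) measurable

lemma lincomb_in_L0:
  assumes [measurable]: "F \<in> L0 M" "H \<in> L0 M"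
  shows "lincomb M a F b H \<in> L0 M"
  unfolding lincomb_def by (rule L0_class_in_L0) measurable

lemma L0_plus_iff:
  assumes "prob_space M"
  shows "F \<in> L0_plus M \<longleftrightarrow> F \<in> L0 M \<and> (AE x in M. 0 \<le> rep F x)"
proof -
  interpret prob_space M by fact
  have "measure M {x \<in> space M. rep F x < 0} = 0 \<longleftrightarrow> (AE x in M. 0 \<le> rep F x)" if [measurable]: "F \<in> L0 M"
    by (subst prob_eq_0) (auto simp: not_less)
  then show ?thesis by (auto simp: L0_plus_def)
qed

lemma L0_closed_AE_limit:
  assumes M: "prob_space M" and K: "closedin (L0_topology M) K"
    and U: "\<And>n. U n \<in> K" and F: "F \<in> L0 M" and lim: "AE x in M. (\<lambda>n. rep (U n) x) \<longlonglongrightarrow> rep F x"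
  shows "F \<in> K"
proof -
  interpret prob_space M by fact
  interpret L: Metric_space "L0 M" "L0_dist M" by (rule Metric_space_L0[OF M])
  have K': "K \<subseteq> L0 M" "\<And>\<sigma> l. range \<sigma> \<subseteq> K \<Longrightarrow> limitin L.mtopology \<sigma> l sequentially \<Longrightarrow> l \<in> K"
    using K unfolding L0_topology_def L.metric_closedin_iff_sequentially_closed by auto
  have U': "U n \<in> L0 M" for n using U K'(1) by auto
  note [measurable] = rep_measurable[OF U'] rep_measurable[OF F]
  have "(\<lambda>n. L0_dist M (U n) F) \<longlonglongrightarrow> (\<integral>x. 0 \<partial>M)"
    unfolding L0_dist_def
  proof (rule integral_dominated_convergence[where w="\<lambda>_. 1"])
    show "AE x in M. (\<lambda>n. min \<bar>rep (U n) x - rep F x\<bar> 1) \<longlonglongrightarrow> 0" using lim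
    proof eventually_elim
      case (elim x)
      have "(\<lambda>n. min \<bar>rep (U n) x - rep F x\<bar> 1) \<longlonglongrightarrow> min \<bar>rep F x - rep F x\<bar> 1"
        by (intro tendsto_intros elim)
      then show ?case by simp
    qed
  qed auto
  then have "limitin L.mtopology U F sequentially"
    unfolding L.limitin_metric_dist_null using F U' by simp
  then show ?thesis using K'(2)[of U F] U by auto
qed

lemma L0_closedI:
  assumes M: "prob_space M" and sub: "K \<subseteq> L0 M"
    and closed: "\<And>U F. (\<And>n. U n \<in> K) \<Longrightarrow> F \<in> L0 M \<Longrightarrow>
      (AE x in M. (\<lambda>n. rep (U n) x) \<longlonglongrightarrow> rep F x) \<Longrightarrow> F \<in> K"
  shows "closedin (L0_topology M) K"
proof -
  interpret prob_space M by fact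
  interpret L: Metric_space "L0 M" "L0_dist M" by (rule Metric_space_L0[OF M])
  have "F \<in> K" if U: "range U \<subseteq> K" and lim: "limitin L.mtopology U F sequentially" for U F
  proof -
    have F: "F \<in> L0 M" and dist: "(\<lambda>n. L0_dist M (U n) F) \<longlonglongrightarrow> 0"
      using lim unfolding L.limitin_metric_dist_null by auto
    have U': "U n \<in> L0 M" for n using U sub by auto
    note [measurable] = rep_measurable[OF U'] rep_measurable[OF F]
    let ?d = "\<lambda>n x. min \<bar>rep (U n) x - rep F x\<bar> 1"
    have "\<exists>r::nat\<Rightarrow>nat. strict_mono r \<and> (AE x in M. (\<lambda>n. ?d (r n) x) \<longlonglongrightarrow> 0)"
    proof (rule tendsto_L1_AE_subseq)
      show "integrable M (?d n)" for n by (rule integrable_const_bound[where B=1]) auto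
      show "(\<lambda>n. \<integral>x. norm (?d n x) \<partial>M) \<longlonglongrightarrow> 0" using dist by (simp add: L0_dist_def)
    qed
    then obtain r :: "nat \<Rightarrow> nat" where r: "AE x in M. (\<lambda>n. ?d (r n) x) \<longlonglongrightarrow> 0" by blast
    have "AE x in M. (\<lambda>n. rep (U (r n)) x) \<longlonglongrightarrow> rep F x" using r
    proof eventually_elim
      case (elim x)
      have "eventually (\<lambda>n. ?d (r n) x < 1) sequentially" using elim by (rule order_tendstoD) simp
      then have "eventually (\<lambda>n. ?d (r n) x = \<bar>rep (U (r n)) x - rep F x\<bar>) sequentially"
        by eventually_elim auto
      with elim have "(\<lambda>n. \<bar>rep (U (r n)) x - rep F x\<bar>) \<longlonglongrightarrow> 0" by (rule Lim_transform_eventually)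
      then show ?case by (simp add: LIM_zero_iff tendsto_rabs_zero_iff)
    qed
    then show ?thesis using closed[of "\<lambda>n. U (r n)" F] U F by auto
  qed
  then show ?thesis unfolding L0_topology_def L.metric_closedin_iff_sequentially_closed using sub by blast
qed

lemma tail_sup_tendsto_0I:
  fixes K :: "('a \<Rightarrow> real) set set"
  assumes meas: "\<And>F. F \<in> K \<Longrightarrow> rep F \<in> borel_measurable Q"
    and R: "\<And>\<epsilon>. 0 < \<epsilon> \<Longrightarrow> \<exists>l. \<forall>F\<in>K. emeasure Q {x \<in> space Q. rep F x > l} \<le> ennreal \<epsilon>"
  shows "((\<lambda>l::real. SUP F\<in>K. emeasure Q {x \<in> space Q. rep F x > l}) \<longlongrightarrow> 0) at_top"
proof (rule order_tendstoI)
  fix a :: ennreal assume "0 < a"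
  then obtain b where b: "0 < b" "b < a" using dense[of 0 a] by blast
  then obtain \<epsilon> where \<epsilon>: "b = ennreal \<epsilon>" "0 < \<epsilon>"
    by (cases b rule: ennreal_cases) (auto simp: ennreal_less_zero_iff)
  obtain l where l: "\<And>F. F \<in> K \<Longrightarrow> emeasure Q {x \<in> space Q. rep F x > l} \<le> ennreal \<epsilon>"
    using R \<epsilon>(2) by blast
  have "(SUP F\<in>K. emeasure Q {x \<in> space Q. rep F x > m}) < a" if "l \<le> m" for m
  proof -
    have "(SUP F\<in>K. emeasure Q {x \<in> space Q. rep F x > m}) \<le> ennreal \<epsilon>"
    proof (rule SUP_least)
      fix F assume F: "F \<in> K"
      note [measurable] = meas[OF F]
      have "emeasure Q {x \<in> space Q. rep F x > m} \<le> emeasure Q {x \<in> space Q. rep F x > l}"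
        using that by (intro emeasure_mono) auto
      then show "emeasure Q {x \<in> space Q. rep F x > m} \<le> ennreal \<epsilon>" using l[OF F] by (rule order_trans)
    qed
    then show ?thesis using b(2) \<epsilon>(1) by simp
  qed
  then show "eventually (\<lambda>m. (SUP F\<in>K. emeasure Q {x \<in> space Q. rep F x > m}) < a) at_top"
    by (auto simp: eventually_at_top_linorder)
qed simp

text \<open>The members of the family whose intersection is \<open>cs M G C\<close>; closure properties of the intersection
are verified member by member.\<close>

definition cs_admissible ::
  "'a measure \<Rightarrow> ('a \<Rightarrow> real) set \<Rightarrow> ('a \<Rightarrow> real) set set \<Rightarrow> ('a \<Rightarrow> real) set set \<Rightarrow> bool" where
  "cs_admissible M G C K \<longleftrightarrow> K \<subseteq> L0_plus M \<and> C \<subseteq> K \<and>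
     L0_convex M K \<and> closedin (L0_topology M) K \<and>
     (\<forall>F\<in>K. \<forall>\<delta>\<ge>0. lincomb M (1 + \<delta>) F (- \<delta>) G \<in> L0_plus M \<longrightarrow>
        lincomb M (1 + \<delta>) F (- \<delta>) G \<in> K)"

lemma cs_iff: "F \<in> cs M G C \<longleftrightarrow> (\<forall>K. cs_admissible M G C K \<longrightarrow> F \<in> K)"
  by (auto simp: cs_def cs_admissible_def)

lemma cs_superset: "F \<in> C \<Longrightarrow> F \<in> cs M G C"
  by (auto simp: cs_iff cs_admissible_def)

lemma cs_convex:
  assumes "F \<in> cs M G C" "H \<in> cs M G C" "0 \<le> t" "t \<le> 1"
  shows "lincomb M (1 - t) F t H \<in> cs M G C"
  using assms unfolding cs_iff cs_admissible_def L0_convex_def by auto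

lemma cs_extrapolate:
  assumes "F \<in> cs M G C" "0 \<le> \<delta>" "lincomb M (1 + \<delta>) F (- \<delta>) G \<in> L0_plus M"
  shows "lincomb M (1 + \<delta>) F (- \<delta>) G \<in> cs M G C"
  using assms unfolding cs_iff cs_admissible_def by auto

lemma cs_AE_limit:
  assumes "prob_space M" "\<And>n. U n \<in> cs M G C" "F \<in> L0 M" "AE x in M. (\<lambda>n. rep (U n) x) \<longlonglongrightarrow> rep F x"
  shows "F \<in> cs M G C"
  unfolding cs_iff
proof (intro allI impI)
  fix K assume K: "cs_admissible M G C K"
  then have "closedin (L0_topology M) K" by (simp add: cs_admissible_def)
  moreover have "U n \<in> K" for n using assms(2) K by (auto simp: cs_iff)
  ultimately show "F \<in> K" using L0_closed_AE_limit[OF assms(1) _ _ assms(3,4)] by blast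
qed

section \<open>The equivalence\<close>

text \<open>The classes that vanish with \<open>g\<close> and whose ratio to \<open>g\<close> has expectation at most \<open>Q[g > 0]\<close> form an admissible
set \<open>K\<close>: the constraint is linear, Fatou's lemma closes it, and extrapolation away from \<open>g\<close> keeps it
because \<open>g\<close> itself satisfies it with equality.  Markov's inequality for \<open>F / g\<close> bounds \<open>K\<close>.\<close>

lemma numeraire_imp_cs_bounded:
  assumes M: "prob_space M" and C: "C \<subseteq> L0_plus M" and num: "numeraire M C g"
  shows "L0_bounded M (cs M g C)"
proof -
  interpret prob_space M by fact
  obtain Q where Q: "Q \<in> equiv_probs M" and num_Q: "\<And>F. F \<in> C \<Longrightarrow>
      (\<integral>\<^sup>+x. ennreal (rep F x / rep g x) * indicator {x \<in> space Q. rep g x > 0} x \<partial>Q)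
        \<le> emeasure Q {x \<in> space Q. rep g x > 0}"
    and g: "g \<in> C" and pos: "strictly_positive_on M C g"
    using num unfolding numeraire_def by blast
  interpret Q: prob_space Q by (rule equiv_probsD(1)[OF Q])
  note AE_Q = equiv_probs_AE_iff[OF Q]
  have plus: "F \<in> L0_plus M \<longleftrightarrow> F \<in> L0 M \<and> (AE x in M. 0 \<le> rep F x)" for F by (rule L0_plus_iff[OF M])
  have g0: "g \<in> L0 M" "AE x in M. 0 \<le> rep g x" using C g plus by auto
  have L0_Q: "rep F \<in> borel_measurable Q" if "F \<in> L0 M" for F
    by (rule equiv_probsD(4)[OF Q rep_measurable[OF that]])
  note [measurable] = L0_Q[OF g0(1)]
  define P where "P = {x \<in> space Q. rep g x > 0}"
  have P[measurable]: "P \<in> sets Q" unfolding P_def by measurable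
  define I where "I F = (\<integral>\<^sup>+x. ennreal (rep F x / rep g x) * indicator P x \<partial>Q)" for F
  define K where "K = {F \<in> L0_plus M. (AE x in M. rep g x \<le> 0 \<longrightarrow> rep F x = 0) \<and> I F \<le> emeasure Q P}"
  have K_L0: "F \<in> L0 M" if "F \<in> K" for F using that plus by (auto simp: K_def)
  have "cs_admissible M g C K"
    unfolding cs_admissible_def
  proof (intro conjI ballI allI impI)
    show "K \<subseteq> L0_plus M" by (auto simp: K_def)
    show "C \<subseteq> K"
    proof
      fix F assume F: "F \<in> C"
      have FL: "F \<in> L0 M" "AE x in M. 0 \<le> rep F x" using C F plus by auto
      note [measurable] = rep_measurable[OF FL(1)] rep_measurable[OF g0(1)]
      have "prob {x \<in> space M. rep F x > 0 \<and> rep g x = 0} = 0"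
        using pos F by (simp add: strictly_positive_on_def)
      then have "AE x in M. \<not> (rep F x > 0 \<and> rep g x = 0)" by (subst (asm) prob_eq_0) auto
      then have "AE x in M. rep g x \<le> 0 \<longrightarrow> rep F x = 0"
        using FL(2) g0(2) by eventually_elim auto
      then show "F \<in> K" using F C num_Q[OF F] by (auto simp: K_def I_def P_def)
    qed
    show "L0_convex M K"
      unfolding L0_convex_def
    proof (intro ballI)
      fix F H and t :: real assume F: "F \<in> K" and H: "H \<in> K" and t: "t \<in> {0..1}"
      let ?L = "lincomb M (1 - t) F t H"
      note FL = K_L0[OF F] and HL = K_L0[OF H]
      note [measurable] = L0_Q[OF FL] L0_Q[OF HL]
      have F0: "AE x in M. 0 \<le> rep F x" "AE x in M. rep g x \<le> 0 \<longrightarrow> rep F x = 0"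
        and H0: "AE x in M. 0 \<le> rep H x" "AE x in M. rep g x \<le> 0 \<longrightarrow> rep H x = 0"
        using F H plus by (auto simp: K_def)
      note eq = AE_rep_lincomb[OF FL HL, of "1 - t" t]
      have L: "?L \<in> L0 M" by (rule lincomb_in_L0[OF FL HL])
      have "AE x in M. 0 \<le> rep ?L x" using eq F0(1) H0(1) by eventually_elim (use t in auto)
      moreover have "AE x in M. rep g x \<le> 0 \<longrightarrow> rep ?L x = 0"
        using eq F0(2) H0(2) by eventually_elim auto
      moreover have "I ?L \<le> emeasure Q P"
      proof -
        have "I ?L = (\<integral>\<^sup>+x. ennreal (1 - t) * (ennreal (rep F x / rep g x) * indicator P x)
            + ennreal t * (ennreal (rep H x / rep g x) * indicator P x) \<partial>Q)"
          unfolding I_def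
        proof (rule nn_integral_cong_AE)
          show "AE x in Q. ennreal (rep ?L x / rep g x) * indicator P x
            = ennreal (1 - t) * (ennreal (rep F x / rep g x) * indicator P x)
            + ennreal t * (ennreal (rep H x / rep g x) * indicator P x)"
            using eq F0(1) H0(1) unfolding AE_Q
          proof eventually_elim
            case (elim x)
            show ?case
            proof (cases "x \<in> P")
              case True
              then have g: "0 < rep g x" by (simp add: P_def)
              have "ennreal (rep ?L x / rep g x) = ennreal ((1 - t) * (rep F x / rep g x) + t * (rep H x / rep g x))"
                using elim g by (simp add: add_divide_distrib)
              also have "\<dots> = ennreal ((1 - t) * (rep F x / rep g x)) + ennreal (t * (rep H x / rep g x))"
                using elim g t by (intro ennreal_plus) auto
              also have "ennreal ((1 - t) * (rep F x / rep g x)) = ennreal (1 - t) * ennreal (rep F x / rep g x)"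
                using elim g t by (intro ennreal_mult) auto
              also have "ennreal (t * (rep H x / rep g x)) = ennreal t * ennreal (rep H x / rep g x)"
                using elim g t by (intro ennreal_mult) auto
              finally show ?thesis using True by simp
            qed simp
          qed
        qed
        also have "\<dots> = ennreal (1 - t) * I F + ennreal t * I H"
          unfolding I_def by (subst nn_integral_add) (simp_all add: nn_integral_cmult)
        also have "\<dots> \<le> ennreal (1 - t) * emeasure Q P + ennreal t * emeasure Q P"
          using F H by (intro add_mono mult_left_mono) (auto simp: K_def)
        also have "\<dots> = (ennreal (1 - t) + ennreal t) * emeasure Q P" by (simp only: distrib_right)
        also have "ennreal (1 - t) + ennreal t = 1"
          using t ennreal_plus[of "1 - t" t] by simp
        finally show ?thesis by simp
      qed
      ultimately show "?L \<in> K" using L by (simp add: K_def plus)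
    qed
    show "closedin (L0_topology M) K"
    proof (rule L0_closedI[OF M])
      show "K \<subseteq> L0 M" using K_L0 by blast
      fix U F assume U: "\<And>n. U n \<in> K" and F: "F \<in> L0 M"
        and lim: "AE x in M. (\<lambda>n. rep (U n) x) \<longlonglongrightarrow> rep F x"
      note [measurable] = L0_Q[OF K_L0[OF U]] L0_Q[OF F]
      have U0: "AE x in M. \<forall>n. 0 \<le> rep (U n) x" "AE x in M. \<forall>n. rep g x \<le> 0 \<longrightarrow> rep (U n) x = 0"
        unfolding AE_all_countable using U plus by (auto simp: K_def)
      have "AE x in M. 0 \<le> rep F x"
        using U0(1) lim by eventually_elim (rule LIMSEQ_le_const, auto)
      moreover have "AE x in M. rep g x \<le> 0 \<longrightarrow> rep F x = 0"
        using U0(2) lim by eventually_elim (auto intro: LIMSEQ_unique)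
      moreover have "I F \<le> emeasure Q P"
      proof -
        have "I F = (\<integral>\<^sup>+x. liminf (\<lambda>n. ennreal (rep (U n) x / rep g x) * indicator P x) \<partial>Q)"
          unfolding I_def
        proof (rule nn_integral_cong_AE)
          show "AE x in Q. ennreal (rep F x / rep g x) * indicator P x
            = liminf (\<lambda>n. ennreal (rep (U n) x / rep g x) * indicator P x)"
            using lim unfolding AE_Q
          proof eventually_elim
            case (elim x)
            show ?case
            proof (cases "x \<in> P")
              case True
              then have "(\<lambda>n. ennreal (rep (U n) x / rep g x)) \<longlonglongrightarrow> ennreal (rep F x / rep g x)"
                using elim by (intro tendsto_ennrealI tendsto_divide tendsto_const) (auto simp: P_def)
              from lim_imp_Liminf[OF _ this] show ?thesis using True by simp
            qed (simp add: Liminf_const)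
          qed
        qed
        also have "\<dots> \<le> liminf (\<lambda>n. I (U n))" unfolding I_def by (rule nn_integral_liminf) measurable
        also have "\<dots> \<le> emeasure Q P" using U by (intro Liminf_le always_eventually) (auto simp: K_def)
        finally show ?thesis .
      qed
      ultimately show "F \<in> K" using F by (simp add: K_def plus)
    qed
    fix F and \<delta> :: real
    let ?L = "lincomb M (1 + \<delta>) F (- \<delta>) g"
    assume F: "F \<in> K" and \<delta>: "0 \<le> \<delta>" and L: "?L \<in> L0_plus M"
    note FL = K_L0[OF F]
    note [measurable] = L0_Q[OF FL]
    note eq = AE_rep_lincomb[OF FL g0(1), of "1 + \<delta>" "- \<delta>"]
    have LL: "?L \<in> L0 M" "AE x in M. 0 \<le> rep ?L x" using L plus by auto
    note [measurable] = L0_Q[OF LL(1)]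
    have F0: "AE x in M. 0 \<le> rep F x" "AE x in M. rep g x \<le> 0 \<longrightarrow> rep F x = 0"
      using F plus by (auto simp: K_def)
    have "AE x in M. rep g x \<le> 0 \<longrightarrow> rep ?L x = 0"
      using eq F0(2) g0(2) by eventually_elim auto
    moreover have "I ?L \<le> emeasure Q P"
    proof -
      have "I ?L + ennreal \<delta> * emeasure Q P
          = (\<integral>\<^sup>+x. ennreal (rep ?L x / rep g x) * indicator P x + ennreal \<delta> * indicator P x \<partial>Q)"
        unfolding I_def by (subst nn_integral_add) (simp_all add: nn_integral_cmult)
      also have "\<dots> = (\<integral>\<^sup>+x. ennreal (1 + \<delta>) * (ennreal (rep F x / rep g x) * indicator P x) \<partial>Q)"
      proof (rule nn_integral_cong_AE)
        show "AE x in Q. ennreal (rep ?L x / rep g x) * indicator P x + ennreal \<delta> * indicator P x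
          = ennreal (1 + \<delta>) * (ennreal (rep F x / rep g x) * indicator P x)"
          using eq F0(1) LL(2) unfolding AE_Q
        proof eventually_elim
          case (elim x)
          show ?case
          proof (cases "x \<in> P")
            case True
            then have g: "0 < rep g x" by (simp add: P_def)
            have "ennreal (rep ?L x / rep g x) + ennreal \<delta> = ennreal (rep ?L x / rep g x + \<delta>)"
              using elim g \<delta> by (intro ennreal_plus[symmetric]) auto
            also have "rep ?L x / rep g x + \<delta> = (1 + \<delta>) * (rep F x / rep g x)"
              using elim(1) g by (simp add: field_simps)
            also have "ennreal ((1 + \<delta>) * (rep F x / rep g x)) = ennreal (1 + \<delta>) * ennreal (rep F x / rep g x)"
              using elim g \<delta> by (intro ennreal_mult) auto
            finally show ?thesis using True by simp
          qed simp
        qed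
      qed
      also have "\<dots> = ennreal (1 + \<delta>) * I F" unfolding I_def by (rule nn_integral_cmult) measurable
      also have "\<dots> \<le> ennreal (1 + \<delta>) * emeasure Q P" using F by (intro mult_left_mono) (auto simp: K_def)
      also have "\<dots> = emeasure Q P + ennreal \<delta> * emeasure Q P"
        using \<delta> ennreal_plus[of 1 \<delta>] by (simp add: distrib_right)
      finally have le: "ennreal \<delta> * emeasure Q P + I ?L \<le> ennreal \<delta> * emeasure Q P + emeasure Q P"
        by (simp only: add.commute)
      have "ennreal \<delta> * emeasure Q P \<noteq> \<top>" by (simp add: ennreal_mult_eq_top_iff)
      then show ?thesis using le by (simp add: ennreal_add_left_cancel_le)
    qed
    ultimately show "?L \<in> K" using L by (simp add: K_def)
  qed
  then have cs_K: "cs M g C \<subseteq> K" by (auto simp: cs_iff)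
  have "\<exists>l. \<forall>F\<in>cs M g C. emeasure Q {x \<in> space Q. rep F x > l} \<le> ennreal \<epsilon>" if \<epsilon>: "0 < \<epsilon>" for \<epsilon>
  proof -
    obtain n where n: "Q.prob {x \<in> space Q. real n < rep g x} \<le> \<epsilon> / 2"
      using Q.tail_le[of "rep g" "\<epsilon> / 2"] \<epsilon> by auto
    \<comment> \<open>\<open>g < s\<close> outside a small event, so that \<open>F > l\<close> forces \<open>F / g \<ge> l / s\<close>\<close>
    define s where "s = real n + 1"
    have s: "0 < s" by (simp add: s_def)
    define l where "l = 2 * s / \<epsilon>"
    have l: "0 < l" using s \<epsilon> by (simp add: l_def)
    have "emeasure Q {x \<in> space Q. rep F x > l} \<le> ennreal \<epsilon>" if "F \<in> cs M g C" for F
    proof -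
      have F: "F \<in> K" using that cs_K by blast
      note [measurable] = L0_Q[OF K_L0[OF F]]
      have F0: "AE x in Q. rep g x \<le> 0 \<longrightarrow> rep F x = 0" using F unfolding AE_Q by (simp add: K_def)
      let ?B = "{x \<in> P. 1 \<le> ennreal (s / l) * ennreal (rep F x / rep g x)}"
      have B: "?B = {x \<in> space Q. x \<in> P \<and> 1 \<le> ennreal (s / l) * ennreal (rep F x / rep g x)}"
        using sets.sets_into_space[OF P] by blast
      have B_sets: "?B \<in> sets Q" unfolding B by measurable
      have "emeasure Q {x \<in> space Q. rep F x > l} \<le> emeasure Q ({x \<in> space Q. real n < rep g x} \<union> ?B)"
      proof (rule emeasure_mono_AE)
        show "AE x in Q. x \<in> {x \<in> space Q. rep F x > l} \<longrightarrow> x \<in> {x \<in> space Q. real n < rep g x} \<union> ?B"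
          using F0
        proof eventually_elim
          case (elim x)
          show ?case
          proof (intro impI)
            assume x: "x \<in> {x \<in> space Q. rep F x > l}"
            then have gx: "0 < rep g x" using elim l by (auto simp: not_le[symmetric])
            show "x \<in> {x \<in> space Q. real n < rep g x} \<union> ?B"
            proof (cases "real n < rep g x")
              case False
              have "l * rep g x \<le> rep F x * s"
                using x False gx l by (intro mult_mono) (auto simp: s_def)
              then have "1 \<le> s / l * (rep F x / rep g x)" using l gx by (simp add: field_simps)
              then have "ennreal 1 \<le> ennreal (s / l * (rep F x / rep g x))" by (rule ennreal_leI)
              also have "\<dots> = ennreal (s / l) * ennreal (rep F x / rep g x)"
                using s l gx x by (intro ennreal_mult) auto
              finally show ?thesis using x gx by (simp add: P_def)
            qed (use x in auto)
          qed
        qed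
        show "{x \<in> space Q. real n < rep g x} \<union> ?B \<in> sets Q" using B_sets by measurable
      qed
      also have "\<dots> \<le> emeasure Q {x \<in> space Q. real n < rep g x} + emeasure Q ?B"
        by (rule emeasure_subadditive[OF _ B_sets]) measurable
      also have "\<dots> \<le> ennreal (\<epsilon> / 2) + ennreal (\<epsilon> / 2)"
      proof (rule add_mono)
        show "emeasure Q {x \<in> space Q. real n < rep g x} \<le> ennreal (\<epsilon> / 2)"
          using n by (simp add: Q.emeasure_eq_measure ennreal_leI)
        have "emeasure Q ?B \<le> ennreal (s / l) * I F"
          unfolding I_def by (rule nn_integral_Markov_inequality) measurable
        also have "\<dots> \<le> ennreal (s / l) * 1"
          using F Q.emeasure_le_1[of P] by (intro mult_left_mono) (auto simp: K_def intro: order_trans)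
        also have "\<dots> = ennreal (\<epsilon> / 2)" using s \<epsilon> by (simp add: l_def)
        finally show "emeasure Q ?B \<le> ennreal (\<epsilon> / 2)" .
      qed
      also have "\<dots> = ennreal \<epsilon>" using \<epsilon> ennreal_plus[of "\<epsilon>/2" "\<epsilon>/2"] by simp
      finally show ?thesis .
    qed
    then show ?thesis by blast
  qed
  then have "((\<lambda>l::real. SUP F\<in>cs M g C. emeasure Q {x \<in> space Q. rep F x > l}) \<longlongrightarrow> 0) at_top"
    using cs_K K_L0 L0_Q by (intro tail_sup_tendsto_0I) blast+
  then show ?thesis unfolding L0_bounded_def using Q by blast
qed

text \<open>The set \<open>K\<close> divided by \<open>g\<close>.  Where \<open>g\<close> vanishes the ratio carries no information and is set to \<open>1\<close>,
which keeps the set bounded in probability and leaves the contribution of \<open>{g = 0}\<close> to both sides of a separating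
inequality equal.\<close>

definition ratios :: "'a measure \<Rightarrow> ('a \<Rightarrow> real) set set \<Rightarrow> ('a \<Rightarrow> real) set \<Rightarrow> ('a \<Rightarrow> real) set" where
  "ratios M K g = {u \<in> borel_measurable M. (\<forall>x. 0 \<le> u x) \<and> (AE x in M. rep g x \<le> 0 \<longrightarrow> u x = 1) \<and>
     L0_class M (\<lambda>x. u x * rep g x) \<in> K}"

lemma ratios_numeraire_set:
  assumes M: "prob_space M" and g: "g \<in> C" "g \<in> L0_plus M" and Q: "Q \<in> equiv_probs M"
    and tail: "\<And>\<epsilon>. 0 < \<epsilon> \<Longrightarrow> \<exists>l. \<forall>F\<in>cs M g C. emeasure Q {x \<in> space Q. rep F x > l} \<le> ennreal \<epsilon>"
  shows "numeraire_set Q (ratios M (cs M g C) g)"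
proof -
  interpret Q: prob_space Q by (rule equiv_probsD(1)[OF Q])
  note AE_Q = equiv_probs_AE_iff[OF Q]
  let ?D = "ratios M (cs M g C) g"
  let ?c = "\<lambda>u. L0_class M (\<lambda>x. u x * rep g x)"
  have g0: "g \<in> L0 M" "AE x in M. 0 \<le> rep g x" using g(2) L0_plus_iff[OF M] by auto
  note [measurable] = rep_measurable[OF g0(1)]
  have meas: "u \<in> borel_measurable M" and nonneg: "0 \<le> u x" and one: "AE x in M. rep g x \<le> 0 \<longrightarrow> u x = 1"
    and cs: "?c u \<in> cs M g C" if "u \<in> ?D" for u x
    using that by (auto simp: ratios_def)
  have c_L0: "?c u \<in> L0 M" if [measurable]: "u \<in> borel_measurable M" for u
    by (rule L0_class_in_L0) measurable
  have rep_c: "AE x in M. rep (?c u) x = u x * rep g x" if [measurable]: "u \<in> borel_measurable M" for u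
    by (rule AE_rep_L0_class) measurable
  show ?thesis
  proof
    fix f assume "f \<in> ?D"
    then show "f \<in> borel_measurable Q" by (intro equiv_probsD(4)[OF Q] meas)
  next
    fix f x assume "f \<in> ?D"
    then show "0 \<le> f x" by (rule nonneg)
  next
    fix f h and t :: real assume f: "f \<in> ?D" and h: "h \<in> ?D" and t: "0 \<le> t" "t \<le> 1"
    let ?u = "\<lambda>x. (1 - t) * f x + t * h x"
    note [measurable] = meas[OF f] meas[OF h]
    have "?c ?u = lincomb M (1 - t) (?c f) t (?c h)"
    proof (rule L0_class_eqI)
      show "lincomb M (1 - t) (?c f) t (?c h) \<in> L0 M" by (intro lincomb_in_L0 c_L0) measurable
      show "AE x in M. ?u x * rep g x = rep (lincomb M (1 - t) (?c f) t (?c h)) x"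
        using AE_rep_lincomb[OF c_L0[OF meas[OF f]] c_L0[OF meas[OF h]], of "1 - t" t]
          rep_c[OF meas[OF f]] rep_c[OF meas[OF h]]
        by eventually_elim (simp add: algebra_simps)
    qed measurable
    moreover have "lincomb M (1 - t) (?c f) t (?c h) \<in> cs M g C"
      by (rule cs_convex[OF cs[OF f] cs[OF h] t])
    moreover have "AE x in M. rep g x \<le> 0 \<longrightarrow> ?u x = 1"
      using one[OF f] one[OF h] by eventually_elim auto
    moreover have "0 \<le> ?u x" for x using nonneg[OF f] nonneg[OF h] t by simp
    moreover have "?u \<in> borel_measurable M" by measurable
    ultimately show "?u \<in> ?D" unfolding ratios_def by simp
  next
    fix u f assume u: "\<And>n. u n \<in> ?D" and f: "f \<in> borel_measurable Q" and f0: "\<And>x. 0 \<le> f x"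
      and "AE x in Q. (\<lambda>n. u n x) \<longlonglongrightarrow> f x"
    then have lim: "AE x in M. (\<lambda>n. u n x) \<longlonglongrightarrow> f x" by (simp add: AE_Q)
    have fM: "f \<in> borel_measurable M" by (rule equiv_probsD(5)[OF Q f])
    have "AE x in M. \<forall>n. rep g x \<le> 0 \<longrightarrow> u n x = 1" unfolding AE_all_countable using one[OF u] by blast
    then have "AE x in M. rep g x \<le> 0 \<longrightarrow> f x = 1"
      using lim by eventually_elim (auto intro: LIMSEQ_unique)
    moreover have "?c f \<in> cs M g C"
    proof (rule cs_AE_limit[OF M cs[OF u] c_L0[OF fM]])
      have "AE x in M. \<forall>n. rep (?c (u n)) x = u n x * rep g x"
        unfolding AE_all_countable using rep_c[OF meas[OF u]] by blast
      then show "AE x in M. (\<lambda>n. rep (?c (u n)) x) \<longlonglongrightarrow> rep (?c f) x"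
        using rep_c[OF fM] lim
      proof eventually_elim
        case (elim x)
        have "(\<lambda>n. u n x * rep g x) \<longlonglongrightarrow> f x * rep g x" by (rule tendsto_mult_right[OF elim(3)])
        then show ?case using elim(1,2) by simp
      qed
    qed
    ultimately show "f \<in> ?D" using fM f0 unfolding ratios_def by simp
  next
    have "?c (\<lambda>x. 1) = g" by (rule L0_class_eqI) (use g0 in auto)
    then show "(\<lambda>x. 1) \<in> ?D" using cs_superset[OF g(1)] unfolding ratios_def by simp
  next
    fix f and \<delta> :: real assume f: "f \<in> ?D" and \<delta>: "0 \<le> \<delta>" and pos: "\<And>x. 0 \<le> (1 + \<delta>) * f x - \<delta>"
    let ?u = "\<lambda>x. (1 + \<delta>) * f x - \<delta>"
    let ?L = "lincomb M (1 + \<delta>) (?c f) (- \<delta>) g"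
    note [measurable] = meas[OF f]
    have L: "?L \<in> L0 M" by (intro lincomb_in_L0 c_L0 g0(1)) measurable
    have eq: "AE x in M. ?u x * rep g x = rep ?L x"
      using AE_rep_lincomb[OF c_L0[OF meas[OF f]] g0(1), of "1 + \<delta>" "- \<delta>"] rep_c[OF meas[OF f]]
      by eventually_elim (simp add: algebra_simps)
    have "?c ?u = ?L" by (rule L0_class_eqI[OF _ L eq]) measurable
    moreover have "AE x in M. 0 \<le> rep ?L x"
      using eq g0(2)
    proof eventually_elim
      case (elim x)
      then show ?case using mult_nonneg_nonneg[OF pos[of x] elim(2)] by simp
    qed
    then have "?L \<in> cs M g C"
      using L by (intro cs_extrapolate[OF cs[OF f] \<delta>]) (simp add: L0_plus_iff[OF M])
    moreover have "AE x in M. rep g x \<le> 0 \<longrightarrow> ?u x = 1" using one[OF f] by eventually_elim auto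
    moreover have "?u \<in> borel_measurable M" by measurable
    ultimately show "?u \<in> ?D" using pos unfolding ratios_def by simp
  next
    fix \<epsilon> :: real assume \<epsilon>: "0 < \<epsilon>"
    note [measurable] = equiv_probsD(4)[OF Q rep_measurable[OF g0(1)]]
    define w where "w x = (if 0 < rep g x then 1 / rep g x else 0)" for x
    have [measurable]: "w \<in> borel_measurable Q" unfolding w_def by measurable
    obtain n where n: "Q.prob {x \<in> space Q. real n < w x} \<le> \<epsilon> / 2"
      using Q.tail_le[of w "\<epsilon> / 2"] \<epsilon> by auto
    obtain L where L: "\<And>F. F \<in> cs M g C \<Longrightarrow> emeasure Q {x \<in> space Q. rep F x > L} \<le> ennreal (\<epsilon> / 2)"
      using tail[of "\<epsilon> / 2"] \<epsilon> by auto
    \<comment> \<open>\<open>1 / g \<le> n\<close> outside a small event, so that \<open>u > l\<close> forces \<open>u * g > L\<close>; the values \<open>1\<close> of \<open>u\<close> off \<open>{g > 0}\<close> do not exceed \<open>l\<close>\<close>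
    define l where "l = max 1 (\<bar>L\<bar> * real n)"
    have "Q.prob {x \<in> space Q. l < f x} \<le> \<epsilon>" if f: "f \<in> ?D" for f
    proof -
      note [measurable] = equiv_probsD(4)[OF Q meas[OF f]] equiv_probsD(4)[OF Q rep_measurable[OF c_L0[OF meas[OF f]]]]
      let ?B = "{x \<in> space Q. rep (?c f) x > L}"
      have "Q.prob {x \<in> space Q. l < f x} \<le> Q.prob ({x \<in> space Q. real n < w x} \<union> ?B)"
      proof (rule Q.finite_measure_mono_AE)
        show "AE x in Q. x \<in> {x \<in> space Q. l < f x} \<longrightarrow> x \<in> {x \<in> space Q. real n < w x} \<union> ?B"
          using one[OF f] rep_c[OF meas[OF f]] unfolding AE_Q
        proof eventually_elim
          case (elim x)
          show ?case
          proof
            assume x: "x \<in> {x \<in> space Q. l < f x}"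
            then have f1: "1 < f x" "\<bar>L\<bar> * real n < f x" by (auto simp: l_def)
            then have gx: "0 < rep g x" using elim by (auto simp: not_le[symmetric])
            show "x \<in> {x \<in> space Q. real n < w x} \<union> ?B"
            proof (cases "real n < w x")
              case False
              then have n1: "1 \<le> real n * rep g x" using gx by (simp add: w_def field_simps)
              have "\<bar>L\<bar> \<le> \<bar>L\<bar> * (real n * rep g x)" using n1 mult_left_mono[OF n1, of "\<bar>L\<bar>"] by simp
              also have "\<dots> < f x * rep g x" using f1(2) gx by (simp add: mult.assoc[symmetric])
              finally have "L < f x * rep g x" by linarith
              then show ?thesis using x elim(2) by simp
            qed (use x in auto)
          qed
        qed
      qed measurable
      also have "\<dots> \<le> Q.prob {x \<in> space Q. real n < w x} + Q.prob ?B"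
        by (rule measure_subadditive) auto
      also have "\<dots> \<le> \<epsilon> / 2 + \<epsilon> / 2"
        using n L[OF cs[OF f]] \<epsilon> by (intro add_mono) (auto simp: Q.emeasure_eq_measure)
      finally show ?thesis by simp
    qed
    then show "\<exists>l. \<forall>f\<in>?D. Q.prob {x \<in> space Q. l < f x} \<le> \<epsilon>" by blast
  qed
qed

text \<open>The required probability has as its density, with respect to the probability under which
\<open>cs M g C\<close> is bounded, a normalised separating density for the ratios.\<close>

lemma cs_bounded_imp_numeraire:
  assumes M: "prob_space M" and C: "C \<subseteq> L0_plus M" and g: "g \<in> C" and pos: "strictly_positive_on M C g"
    and bdd: "L0_bounded M (cs M g C)"
  shows "numeraire M C g"
proof -
  interpret M: prob_space M by fact
  obtain Q where Q: "Q \<in> equiv_probs M"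
    and tend: "((\<lambda>l::real. SUP F\<in>cs M g C. emeasure Q {x \<in> space Q. rep F x > l}) \<longlongrightarrow> 0) at_top"
    using bdd unfolding L0_bounded_def by blast
  interpret Q: prob_space Q by (rule equiv_probsD(1)[OF Q])
  note AE_Q = equiv_probs_AE_iff[OF Q]
  have tail: "\<exists>l. \<forall>F\<in>cs M g C. emeasure Q {x \<in> space Q. rep F x > l} \<le> ennreal \<epsilon>" if "0 < \<epsilon>" for \<epsilon>
  proof -
    have "eventually (\<lambda>l::real. (SUP F\<in>cs M g C. emeasure Q {x \<in> space Q. rep F x > l}) < ennreal \<epsilon>) at_top"
      using tend that by (intro order_tendstoD(2)) auto
    then obtain l where l: "(SUP F\<in>cs M g C. emeasure Q {x \<in> space Q. rep F x > l}) < ennreal \<epsilon>"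
      using eventually_happens'[OF trivial_limit_at_top_linorder] by blast
    then show ?thesis by (intro exI[of _ l] ballI) (rule order_trans[OF SUP_upper less_imp_le])
  qed
  have gp: "g \<in> L0_plus M" using C g by blast
  then have g0: "g \<in> L0 M" "AE x in M. 0 \<le> rep g x" using L0_plus_iff[OF M] by auto
  note [measurable] = rep_measurable[OF g0(1)] equiv_probsD(4)[OF Q rep_measurable[OF g0(1)]]
  interpret numeraire_set Q "ratios M (cs M g C) g" by (rule ratios_numeraire_set[OF M g gp Q tail])
  show ?thesis
  proof (rule separating_density)
    fix y assume y[measurable]: "y \<in> borel_measurable Q" and y_pos: "AE x in Q. 0 < y x"
      and y_fin: "(\<integral>\<^sup>+x. y x \<partial>Q) < \<infinity>"
      and y_le: "\<And>f. f \<in> ratios M (cs M g C) g \<Longrightarrow> (\<integral>\<^sup>+x. y x * ennreal (f x) \<partial>Q) \<le> (\<integral>\<^sup>+x. y x \<partial>Q)"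
    define T where "T = (\<integral>\<^sup>+x. y x \<partial>Q)"
    have "T \<noteq> 0"
    proof
      assume "T = 0"
      then have "AE x in Q. y x = 0" unfolding T_def by (simp add: nn_integral_0_iff_AE)
      then have "AE x in Q. False" using y_pos by eventually_elim auto
      then show False by simp
    qed
    have T: "T \<noteq> 0" "T \<noteq> \<top>" using \<open>T \<noteq> 0\<close> y_fin by (auto simp: T_def)
    define R where "R = density Q (\<lambda>x. inverse T * y x)"
    have space_R: "space R = space Q" by (simp add: R_def)
    have int_R: "(\<integral>\<^sup>+x. v x \<partial>R) = inverse T * (\<integral>\<^sup>+x. y x * v x \<partial>Q)"
      if [measurable]: "v \<in> borel_measurable Q" for v :: "'a \<Rightarrow> ennreal"
    proof -
      have "(\<integral>\<^sup>+x. v x \<partial>R) = (\<integral>\<^sup>+x. inverse T * y x * v x \<partial>Q)"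
        unfolding R_def by (rule nn_integral_density) measurable
      also have "\<dots> = inverse T * (\<integral>\<^sup>+x. y x * v x \<partial>Q)"
        unfolding mult.assoc by (rule nn_integral_cmult) measurable
      finally show ?thesis .
    qed
    have "R \<in> equiv_probs M"
      unfolding equiv_probs_def
    proof (intro CollectI conjI)
      have "emeasure R (space R) = (\<integral>\<^sup>+x. 1 \<partial>R)" by simp
      also have "\<dots> = inverse T * T" using int_R[of "\<lambda>_. 1"] by (simp add: T_def)
      also have "\<dots> = 1" using T using ennreal_divide_self[of T] by (simp add: divide_ennreal_def mult.commute less_top)
      finally show "prob_space R" by (rule prob_spaceI)
      show "sets R = sets M" by (simp add: R_def equiv_probsD(2)[OF Q])
      have inv: "inverse T \<noteq> 0" using T by simp
      have "A \<in> null_sets R \<longleftrightarrow> A \<in> null_sets Q" for A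
      proof -
        have "A \<in> null_sets R \<longleftrightarrow> A \<in> sets Q \<and> (AE x in Q. x \<in> A \<longrightarrow> inverse T * y x = 0)"
          unfolding R_def by (rule null_sets_density_iff) measurable
        also have "(AE x in Q. x \<in> A \<longrightarrow> inverse T * y x = 0) \<longleftrightarrow> (AE x in Q. x \<notin> A)"
        proof
          assume "AE x in Q. x \<in> A \<longrightarrow> inverse T * y x = 0"
          then show "AE x in Q. x \<notin> A" using y_pos by eventually_elim (use inv in auto)
        next
          assume "AE x in Q. x \<notin> A"
          then show "AE x in Q. x \<in> A \<longrightarrow> inverse T * y x = 0" by eventually_elim auto
        qed
        also have "A \<in> sets Q \<and> (AE x in Q. x \<notin> A) \<longleftrightarrow> A \<in> null_sets Q"
          using AE_iff_null_sets[of A Q] by auto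
        finally show ?thesis .
      qed
      then show "null_sets R = null_sets M" using Q by (auto simp: equiv_probs_def)
    qed
    moreover have "(\<integral>\<^sup>+x. ennreal (rep F x / rep g x) * indicator {x \<in> space R. rep g x > 0} x \<partial>R)
          \<le> emeasure R {x \<in> space R. rep g x > 0}" if F: "F \<in> C" for F
    proof -
      have F0: "F \<in> L0 M" "AE x in M. 0 \<le> rep F x" using C F L0_plus_iff[OF M] by auto
      note [measurable] = rep_measurable[OF F0(1)] equiv_probsD(4)[OF Q rep_measurable[OF F0(1)]]
      define P where "P = {x \<in> space Q. rep g x > 0}"
      have P[measurable]: "P \<in> sets Q" unfolding P_def by measurable
      define u where "u x = (if 0 < rep g x then max 0 (rep F x) / rep g x else 1)" for x
      have u_meas: "u \<in> borel_measurable M" unfolding u_def by measurable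
      have [measurable]: "u \<in> borel_measurable Q" by (rule equiv_probsD(4)[OF Q u_meas])
      have "M.prob {x \<in> space M. rep F x > 0 \<and> rep g x = 0} = 0"
        using pos F by (simp add: strictly_positive_on_def)
      then have "AE x in M. \<not> (rep F x > 0 \<and> rep g x = 0)" by (subst (asm) M.prob_eq_0) auto
      then have eq: "AE x in M. u x * rep g x = rep F x"
        using F0(2) g0(2) by eventually_elim (auto simp: u_def)
      have "L0_class M (\<lambda>x. u x * rep g x) = F"
        using u_meas by (intro L0_class_eqI F0(1) eq) auto
      then have "u \<in> ratios M (cs M g C) g"
        using u_meas cs_superset[OF F] unfolding ratios_def by (auto simp: u_def)
      from y_le[OF this] have le: "(\<integral>\<^sup>+x. y x * ennreal (u x) \<partial>Q) \<le> (\<integral>\<^sup>+x. y x \<partial>Q)" .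
      let ?N = "\<integral>\<^sup>+x. y x * indicator (space Q - P) x \<partial>Q"
      have "(\<integral>\<^sup>+x. y x * (ennreal (u x) * indicator P x) \<partial>Q) + ?N
          = (\<integral>\<^sup>+x. y x * (ennreal (u x) * indicator P x) + y x * indicator (space Q - P) x \<partial>Q)"
        by (rule nn_integral_add[symmetric]) measurable
      also have "\<dots> = (\<integral>\<^sup>+x. y x * ennreal (u x) \<partial>Q)"
        by (intro nn_integral_cong) (auto simp: P_def u_def)
      also have "\<dots> \<le> (\<integral>\<^sup>+x. y x \<partial>Q)" by (rule le)
      also have "\<dots> = (\<integral>\<^sup>+x. y x * indicator P x + y x * indicator (space Q - P) x \<partial>Q)"
        by (intro nn_integral_cong) (auto simp: indicator_def)
      also have "\<dots> = (\<integral>\<^sup>+x. y x * indicator P x \<partial>Q) + ?N"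
        by (rule nn_integral_add) measurable
      finally have le': "?N + (\<integral>\<^sup>+x. y x * (ennreal (u x) * indicator P x) \<partial>Q)
          \<le> ?N + (\<integral>\<^sup>+x. y x * indicator P x \<partial>Q)" by (simp only: add.commute)
      \<comment> \<open>the contribution of \<open>{g = 0}\<close> is finite and cancels\<close>
      have "?N \<le> T" unfolding T_def by (intro nn_integral_mono) (auto simp: indicator_def)
      then have "?N \<noteq> \<top>" using T by (auto simp: top_unique)
      with le' have le'': "(\<integral>\<^sup>+x. y x * (ennreal (u x) * indicator P x) \<partial>Q) \<le> (\<integral>\<^sup>+x. y x * indicator P x \<partial>Q)"
        by (simp add: ennreal_add_left_cancel_le)
      have "(\<integral>\<^sup>+x. ennreal (rep F x / rep g x) * indicator P x \<partial>R)
          = inverse T * (\<integral>\<^sup>+x. y x * (ennreal (rep F x / rep g x) * indicator P x) \<partial>Q)"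
        by (rule int_R) measurable
      also have "(\<integral>\<^sup>+x. y x * (ennreal (rep F x / rep g x) * indicator P x) \<partial>Q)
          = (\<integral>\<^sup>+x. y x * (ennreal (u x) * indicator P x) \<partial>Q)"
        using F0(2) unfolding AE_Q[symmetric]
        by (intro nn_integral_cong_AE, eventually_elim) (auto simp: P_def u_def indicator_def)
      also have "inverse T * \<dots> \<le> inverse T * (\<integral>\<^sup>+x. y x * indicator P x \<partial>Q)"
        by (rule mult_left_mono[OF le'']) simp
      also have "\<dots> = (\<integral>\<^sup>+x. indicator P x \<partial>R)" by (rule int_R[symmetric]) measurable
      also have "\<dots> = emeasure R P" by (rule nn_integral_indicator) (simp add: R_def P)
      finally show ?thesis unfolding space_R P_def .
    qed
    ultimately show ?thesis unfolding numeraire_def using g pos by blast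
  qed
qed

theorem theorem1p4:
  fixes M :: "'a measure"
    and C :: "('a \<Rightarrow> real) set set"
    and g :: "('a \<Rightarrow> real) set"
  assumes "prob_space M"
    and "C \<subseteq> L0_plus M"
    and "L0_convex M C"
    and "g \<in> C"
    and "strictly_positive_on M C g"
  shows "numeraire M C g \<longleftrightarrow> L0_bounded M (cs M g C)"
  using numeraire_imp_cs_bounded[OF assms(1,2)] cs_bounded_imp_numeraire[OF assms(1,2,4,5)] by blast

end
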